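(* Let $G$ be a countable, discrete group with a generating probability measure $\mu$ with finite entropy $H(\mu)<\infty$. Let $\Gamma$ be a finite index subgroup of $G$, with hitting measure $\theta$. Then, for any $(G,\mu)$-stationary space $(X,\nu)$, $$h_\theta(X,\nu)=[G:\Gamma]\cdot h_\mu(X,\nu).$$
   Context: Generating: a probability measure $\mu$ on the countable group $G$ is generating if the semigroup generated by its support $\{g\in G : \mu(g)>0\}$ is all of $G$. Its entropy is $H(\mu)=-\sum_{g\in G}\mu(g)\log\mu(g)$, with $0\log 0=0$. Random walk and hitting measure: let $X_1,X_2,\ldots$ be i.i.d. $G$-valued random variables with law $\mu$, and $Z_n=X_1X_2\cdots X_n$ (the $\mu$-random walk on $G$ started at the identity). A finite index subgroup $\Gamma$ is $\mu$-recurrent, i.e. almost surely there is $n\ge 1$ with $Z_n\in\Gamma$. The return time is $\tau=\min\{n\ge 1 : Z_n\in\Gamma\}$, which is almost surely finite, and the hitting measure $\theta$ is the probability measure on $\Gamma$ given by $\theta(\gamma)=\mathbb{P}[Z_\tau=\gamma]$. Stationary spaces: let $X$ be a measurable $G$-space (a measurable space with a $G$-action for which $(g,x)\mapsto gx$ is measurable) and $\nu$ a probability measure on $X$. For $g\in G$ let $g\nu(A)=\nu(g^{-1}A)$. $(X,\nu)$ is $(G,\mu)$-stationary if $\mu*\nu:=\sum_{g\in G}\mu(g)\, g\nu=\nu$. In this case (as $\mu$ is generating) every $g\nu$ is in the same measure class as $\nu$. It is known that a $(G,\mu)$-stationary space, with the action restricted to $\Gamma$, is $(\Gamma,\theta)$-stationary.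 Furstenberg entropy: let $\varphi(g)=\int_X -\log\frac{dg^{-1}\nu}{d\nu}(x)\,d\nu(x)\ge 0$. Then $h_\mu(X,\nu)=\sum_{g\in G}\mu(g)\varphi(g)$ and $h_\theta(X,\nu)=\sum_{\gamma\in\Gamma}\theta(\gamma)\varphi(\gamma)$. *)

theory Defs
  imports "HOL-Probability.Probability" "HOL-Algebra.Group_Action"
begin

inductive_set semigroup_generated :: "('g, 'b) monoid_scheme \<Rightarrow> 'g set \<Rightarrow> 'g set"
  for G :: "('g, 'b) monoid_scheme" and S :: "'g set" where
  incl: "s \<in> S \<Longrightarrow> s \<in> semigroup_generated G S"
| mult: "a \<in> semigroup_generated G S \<Longrightarrow> b \<in> semigroup_generated G S
    \<Longrightarrow> a \<otimes>\<^bsub>G\<^esub> b \<in> semigroup_generated G S"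

definition generating :: "('g, 'b) monoid_scheme \<Rightarrow> 'g pmf \<Rightarrow> bool" where
  "generating G \<mu> \<longleftrightarrow> semigroup_generated G (set_pmf \<mu>) = carrier G"

(* Shannon entropy in [0,\<infinity>]; every summand is nonnegative. *)
definition shannon_entropy :: "('g, 'b) monoid_scheme \<Rightarrow> 'g pmf \<Rightarrow> ennreal" where
  "shannon_entropy G \<mu> =
     (\<integral>\<^sup>+ g. ennreal (- (pmf \<mu> g * ln (pmf \<mu> g))) \<partial>count_space (carrier G))"

(* X i is relevant for i \<ge> 1 only. Measurability into count_space (carrier G), which is
   part of indep_vars, says that the variables take values in the group. *)
definition iid_increments ::
  "('g, 'b) monoid_scheme \<Rightarrow> 'g pmf \<Rightarrow> 'w measure \<Rightarrow> (nat \<Rightarrow> 'w \<Rightarrow> 'g) \<Rightarrow> bool" where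
  "iid_increments G \<mu> P X \<longleftrightarrow> prob_space P \<and>
     prob_space.indep_vars P (\<lambda>_. count_space (carrier G)) X {1..} \<and>
     (\<forall>i\<ge>1. \<forall>g\<in>carrier G. measure P {w \<in> space P. X i w = g} = pmf \<mu> g)"

primrec random_walk ::
  "('g, 'b) monoid_scheme \<Rightarrow> (nat \<Rightarrow> 'w \<Rightarrow> 'g) \<Rightarrow> nat \<Rightarrow> 'w \<Rightarrow> 'g" where
  "random_walk G X 0 w = \<one>\<^bsub>G\<^esub>"
| "random_walk G X (Suc n) w = random_walk G X n w \<otimes>\<^bsub>G\<^esub> X (Suc n) w"

(* Unspecified on the event that the walk never returns to H. That event is null
   when H has finite index, so it does not affect the hitting measure. *)
definition return_time ::
  "('g, 'b) monoid_scheme \<Rightarrow> (nat \<Rightarrow> 'w \<Rightarrow> 'g) \<Rightarrow> 'g set \<Rightarrow> 'w \<Rightarrow> nat" where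
  "return_time G X H w = (LEAST n. 1 \<le> n \<and> random_walk G X n w \<in> H)"

definition hitting_measure ::
  "('g, 'b) monoid_scheme \<Rightarrow> 'w measure \<Rightarrow> (nat \<Rightarrow> 'w \<Rightarrow> 'g) \<Rightarrow> 'g set \<Rightarrow> 'g \<Rightarrow> real" where
  "hitting_measure G P X H h =
     measure P {w \<in> space P. random_walk G X (return_time G X H w) w = h}"

(* The measurable structure of the space is that of \<nu>. The library predicate group_action
   requires each act g to be extensional, i.e. undefined outside space \<nu>. *)
definition measurable_action ::
  "('g, 'b) monoid_scheme \<Rightarrow> ('g \<Rightarrow> 'x \<Rightarrow> 'x) \<Rightarrow> 'x measure \<Rightarrow> bool" where
  "measurable_action G act \<nu> \<longleftrightarrow> group_action G (space \<nu>) act \<and>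
     (\<lambda>(g, x). act g x) \<in> measurable (count_space (carrier G) \<Otimes>\<^sub>M \<nu>) \<nu>"

(* A \<mapsto> \<nu> (g\<inverse> A), since g\<inverse> A is the preimage of A under act g. *)
definition translate :: "('g \<Rightarrow> 'x \<Rightarrow> 'x) \<Rightarrow> 'g \<Rightarrow> 'x measure \<Rightarrow> 'x measure" where
  "translate act g \<nu> = distr \<nu> \<nu> (act g)"

definition stationary_space ::
  "('g, 'b) monoid_scheme \<Rightarrow> 'g pmf \<Rightarrow> ('g \<Rightarrow> 'x \<Rightarrow> 'x) \<Rightarrow> 'x measure \<Rightarrow> bool" where
  "stationary_space G \<mu> act \<nu> \<longleftrightarrow> prob_space \<nu> \<and> measurable_action G act \<nu> \<and>
     (\<forall>A\<in>sets \<nu>. (\<integral>\<^sup>+ g. ennreal (pmf \<mu> g) * emeasure (translate act g \<nu>) A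
                    \<partial>count_space (carrier G)) = emeasure \<nu> A)"

(* RN_deriv \<nu> N is the density dN/d\<nu>. If \<nu> is stationary for a generating measure, the
   density is \<nu>-a.e. bounded away from 0 and \<infinity>, so the integrand is integrable. *)
definition rn_information ::
  "('g, 'b) monoid_scheme \<Rightarrow> ('g \<Rightarrow> 'x \<Rightarrow> 'x) \<Rightarrow> 'x measure \<Rightarrow> 'g \<Rightarrow> real" where
  "rn_information G act \<nu> g =
     (\<integral>x. - ln (enn2real (RN_deriv \<nu> (translate act (inv\<^bsub>G\<^esub> g) \<nu>) x)) \<partial>\<nu>)"

(* The sum over g \<in> S of p g * rn_information g, with value in [0,\<infinity>]. The truncation by
   ennreal is harmless: rn_information is nonnegative by Jensen's inequality. For a
   subgroup S, the inverse in G is also the inverse in S. *)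
definition furstenberg_entropy ::
  "('g, 'b) monoid_scheme \<Rightarrow> 'g set \<Rightarrow> ('g \<Rightarrow> real) \<Rightarrow> ('g \<Rightarrow> 'x \<Rightarrow> 'x) \<Rightarrow> 'x measure \<Rightarrow> ennreal"
  where
  "furstenberg_entropy G S p act \<nu> =
     (\<integral>\<^sup>+ g. ennreal (p g * rn_information G act \<nu> g) \<partial>count_space S)"

end

(* Write l(g, x) = - ln (d(g^-1 nu)/d nu)(x). It is an additive cocycle: l(gh, x) = l(g, hx) + l(h, x).
   Let the walk start from a coset C of Gamma and let A(C) be the expectation of phi(X_1 ... X_s),
   where s >= 0 is the time at which C X_1 ... X_s is first equal to Gamma. Given X_1, the remaining
   product Y = X_2 ... X_s is again such a stopped walk, and optional stopping for the martingales
   k |-> int F(X_2 ... X_k x) d nu(x) says that Yx has law nu when x has. Integrating the cocycle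
   identity therefore gives A(C) = h + (PA)(C) for C different from Gamma, where P is the
   transition operator on cosets and h = h_mu, and h_theta = h + (PA)(Gamma), while A(Gamma) = 0.
   Right multiplication permutes the cosets, so PA and A have the same sum over the cosets, and
   summing the identities gives h_theta = [G:Gamma] h. Positive and negative parts are kept apart
   throughout; the negative part has integral at most 1, because the density has integral 1. *)

theory Submission imports Defs
begin

section \<open>The coset walk\<close>

locale finite_index_walk = group G for G :: "('g, 'b) monoid_scheme" (structure) +
  fixes \<mu> :: "'g pmf" and \<Gamma> :: "'g set"
  assumes supp: "set_pmf \<mu> \<subseteq> carrier G"
    and gen: "generating G \<mu>"
    and subgrp: "subgroup \<Gamma> G"
    and fin: "finite (rcosets \<Gamma>)"
begin

lemma supp_carrier: "g \<in> set_pmf \<mu> \<Longrightarrow> g \<in> carrier G"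
  using supp by auto

lemma mu_cong:
  "(\<And>g. g \<in> set_pmf \<mu> \<Longrightarrow> f g = f' g) \<Longrightarrow> (\<integral>\<^sup>+g. f g \<partial>\<mu>) = (\<integral>\<^sup>+g. f' g \<partial>\<mu>)"
  by (rule nn_integral_cong_AE) (simp add: AE_measure_pmf_iff)

lemma mu_mono:
  "(\<And>g. g \<in> set_pmf \<mu> \<Longrightarrow> f g \<le> f' g) \<Longrightarrow> (\<integral>\<^sup>+g. f g \<partial>\<mu>) \<le> (\<integral>\<^sup>+g. f' g \<partial>\<mu>)"
  by (rule nn_integral_mono_AE) (simp add: AE_measure_pmf_iff)

lemma mu_const: "(\<integral>\<^sup>+g. c \<partial>\<mu>) = c"
  by (simp add: measure_pmf.emeasure_space_1[of \<mu>, simplified])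

section \<open>Right translation on the cosets\<close>

lemma sub_carrier: "\<Gamma> \<subseteq> carrier G"
  using subgrp by (simp add: subgroup.subset)

lemma trivial_coset: "\<Gamma> \<in> rcosets \<Gamma>"
  using subgroup.subgroup_in_rcosets[OF subgrp is_group] .

lemma coset_mult: "a \<in> carrier G \<Longrightarrow> b \<in> carrier G \<Longrightarrow> \<Gamma> #> a #> b = \<Gamma> #> (a \<otimes> b)"
  using coset_mult_assoc[OF sub_carrier] .

lemma coset_carrier: "C \<in> rcosets \<Gamma> \<Longrightarrow> C \<subseteq> carrier G"
  using rcosets_part_G[OF subgrp] by auto

lemma translate_coset: "C \<in> rcosets \<Gamma> \<Longrightarrow> g \<in> carrier G \<Longrightarrow> C #> g \<in> rcosets \<Gamma>"
  by (auto simp: RCOSETS_def coset_mult)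

lemma coset_eq_iff: "h \<in> carrier G \<Longrightarrow> \<Gamma> #> h = \<Gamma> \<longleftrightarrow> h \<in> \<Gamma>"
  using coset_join1[OF _ _ subgrp] coset_join2[OF _ subgrp] by blast

lemma bij_translate_cosets:
  assumes g: "g \<in> carrier G"
  shows "bij_betw (\<lambda>C. C #> g) (rcosets \<Gamma>) (rcosets \<Gamma>)"
proof (rule bij_betw_byWitness[where f' = "\<lambda>C. C #> inv g"])
  show "\<forall>C\<in>rcosets \<Gamma>. C #> g #> inv g = C" "\<forall>C\<in>rcosets \<Gamma>. C #> inv g #> g = C"
    using g coset_carrier by (auto simp: coset_mult_assoc)
qed (use g translate_coset in auto)

lemma sum_translate_cosets:
  "g \<in> carrier G \<Longrightarrow> (\<Sum>C\<in>rcosets \<Gamma>. f (C #> g)) = (\<Sum>C\<in>rcosets \<Gamma>. f C)"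
  using sum.reindex_bij_betw[OF bij_translate_cosets] .

lemma sum_step:
  "(\<Sum>C\<in>rcosets \<Gamma>. \<integral>\<^sup>+g. f (C #> g) \<partial>\<mu>) = (\<Sum>C\<in>rcosets \<Gamma>. f C :: ennreal)"
proof -
  have "(\<Sum>C\<in>rcosets \<Gamma>. \<integral>\<^sup>+g. f (C #> g) \<partial>\<mu>) = (\<integral>\<^sup>+g. (\<Sum>C\<in>rcosets \<Gamma>. f (C #> g)) \<partial>\<mu>)"
    by (simp add: nn_integral_sum)
  also have "\<dots> = (\<integral>\<^sup>+g. (\<Sum>C\<in>rcosets \<Gamma>. f C) \<partial>\<mu>)"
    by (intro mu_cong sum_translate_cosets supp_carrier)
  finally show ?thesis unfolding mu_const .
qed

text \<open>Irreducibility of the coset walk: the support generates the group as a semigroup, so a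
  property that survives each step in the support spreads from one coset to all of them.\<close>

lemma coset_reachable:
  assumes C: "C \<in> rcosets \<Gamma>" "Q C" and D: "D \<in> rcosets \<Gamma>"
    and step: "\<And>C g. C \<in> rcosets \<Gamma> \<Longrightarrow> Q C \<Longrightarrow> g \<in> set_pmf \<mu> \<Longrightarrow> Q (C #> g)"
  shows "Q D"
proof -
  have closed: "Q (C #> g)"
    if "g \<in> semigroup_generated G (set_pmf \<mu>)" "C \<in> rcosets \<Gamma>" "Q C" for g C
    using that
  proof (induction arbitrary: C rule: semigroup_generated.induct)
    case (incl s)
    then show ?case using step by blast
  next
    case (mult a b)
    have ab: "a \<in> carrier G" "b \<in> carrier G"
      using mult.hyps gen by (auto simp: generating_def)
    have "Q (C #> a #> b)"
      using mult.IH mult.prems translate_coset ab by blast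
    then show ?case
      using ab mult.prems coset_carrier by (simp add: coset_mult_assoc)
  qed
  obtain a b where ab: "a \<in> carrier G" "b \<in> carrier G" "C = \<Gamma> #> a" "D = \<Gamma> #> b"
    using C D by (auto simp: RCOSETS_def)
  \<comment> \<open>Any two cosets differ by one group element, which is a product of support
    elements.\<close>
  have "C #> (inv a \<otimes> b) = D"
    using ab coset_mult[of a "inv a \<otimes> b"] by (simp add: m_assoc[symmetric])
  moreover have "inv a \<otimes> b \<in> semigroup_generated G (set_pmf \<mu>)"
    using ab gen by (simp add: generating_def)
  ultimately show ?thesis
    using closed C by metis
qed

text \<open>The expectation of \<open>f (X\<^sub>1 \<cdots> X\<^sub>\<sigma>)\<close> on the event \<open>\<sigma> < n\<close>, where \<open>\<sigma> \<ge> 0\<close> is the first time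
  at which the coset walk \<open>C X\<^sub>1 \<cdots> X\<^sub>k\<close> is at \<open>\<Gamma>\<close>.\<close>

primrec hit_within :: "nat \<Rightarrow> 'g set \<Rightarrow> ('g \<Rightarrow> ennreal) \<Rightarrow> ennreal" where
  "hit_within 0 C f = 0"
| "hit_within (Suc n) C f =
     (if C = \<Gamma> then f \<one> else \<integral>\<^sup>+g. hit_within n (C #> g) (\<lambda>h. f (g \<otimes> h)) \<partial>\<mu>)"

text \<open>By monotone convergence, this is the expectation on the event that the walk from
  \<open>C\<close> reaches the subgroup at all.\<close>

definition hit :: "'g set \<Rightarrow> ('g \<Rightarrow> ennreal) \<Rightarrow> ennreal" where
  "hit C f = (SUP n. hit_within n C f)"

section \<open>Linearity and first-step analysis of the stopped expectation\<close>

lemma hit_within_mono: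
  assumes "\<And>h. h \<in> carrier G \<Longrightarrow> f h \<le> f' h"
  shows "hit_within n C f \<le> hit_within n C f'"
  using assms
proof (induction n arbitrary: C f f')
  case (Suc n)
  have "hit_within n (C #> g) (\<lambda>h. f (g \<otimes> h)) \<le> hit_within n (C #> g) (\<lambda>h. f' (g \<otimes> h))"
    if "g \<in> set_pmf \<mu>" for g
    by (rule Suc.IH) (use Suc.prems supp_carrier[OF that] in auto)
  then show ?case
    using Suc.prems by (auto intro!: mu_mono)
qed simp

lemma hit_within_cong:
  "(\<And>h. h \<in> carrier G \<Longrightarrow> f h = f' h) \<Longrightarrow> hit_within n C f = hit_within n C f'"
  by (intro antisym hit_within_mono) auto

lemma hit_within_add:
  "hit_within n C (\<lambda>h. f h + f' h) = hit_within n C f + hit_within n C f'"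
  by (induction n arbitrary: C f f') (simp_all add: nn_integral_add)

lemma hit_within_cmult:
  "hit_within n C (\<lambda>h. c * f h) = c * hit_within n C f"
  by (induction n arbitrary: C f) (simp_all add: nn_integral_cmult)

lemma hit_within_Suc_ge: "hit_within n C f \<le> hit_within (Suc n) C f"
proof (induction n arbitrary: C f)
  case (Suc n)
  have "(\<integral>\<^sup>+g. hit_within n (C #> g) (\<lambda>h. f (g \<otimes> h)) \<partial>\<mu>)
      \<le> (\<integral>\<^sup>+g. hit_within (Suc n) (C #> g) (\<lambda>h. f (g \<otimes> h)) \<partial>\<mu>)"
    by (intro nn_integral_mono Suc.IH)
  then show ?case by simp
qed simp

lemma incseq_hit_within: "incseq (\<lambda>n. hit_within n C f)"
  by (intro incseq_SucI hit_within_Suc_ge)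

lemma hit_mono:
  "(\<And>h. h \<in> carrier G \<Longrightarrow> f h \<le> f' h) \<Longrightarrow> hit C f \<le> hit C f'"
  unfolding hit_def by (intro SUP_mono') (rule hit_within_mono)

lemma hit_cong:
  "(\<And>h. h \<in> carrier G \<Longrightarrow> f h = f' h) \<Longrightarrow> hit C f = hit C f'"
  by (intro antisym hit_mono) auto

lemma hit_add: "hit C (\<lambda>h. f h + f' h) = hit C f + hit C f'"
  unfolding hit_def hit_within_add by (rule ennreal_SUP_add[OF incseq_hit_within incseq_hit_within])

lemma hit_cmult: "hit C (\<lambda>h. c * f h) = c * hit C f"
  unfolding hit_def hit_within_cmult by (simp add: SUP_mult_left_ennreal)

lemma hit_trivial_coset: "hit \<Gamma> f = f \<one>"
proof -
  have "hit \<Gamma> f = (SUP n. hit_within (Suc n) \<Gamma> f)"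
    unfolding hit_def by (intro antisym SUP_mono)
      (blast intro: hit_within_Suc_ge, blast)
  then show ?thesis by simp
qed

lemma nn_integral_hit: "(\<integral>\<^sup>+g. hit (D g) (k g) \<partial>\<mu>) = (SUP n. \<integral>\<^sup>+g. hit_within n (D g) (k g) \<partial>\<mu>)"
  unfolding hit_def
  by (rule nn_integral_monotone_convergence_SUP)
    (auto simp: incseq_def le_fun_def intro: incseqD[OF incseq_hit_within])

text \<open>Condition on the first increment. The level \<open>n = 0\<close> may be dropped from the
  supremum because the sequence increases.\<close>

lemma hit_step:
  assumes "C \<noteq> \<Gamma>"
  shows "hit C f = (\<integral>\<^sup>+g. hit (C #> g) (\<lambda>h. f (g \<otimes> h)) \<partial>\<mu>)"
proof -
  have "hit C f = (SUP n. hit_within (Suc n) C f)"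
    unfolding hit_def by (intro antisym SUP_mono)
      (blast intro: hit_within_Suc_ge, blast)
  then show ?thesis using assms by (simp add: nn_integral_hit)
qed

section \<open>Almost sure hitting of the subgroup\<close>

lemma hit_within_one_le: "hit_within n C (\<lambda>_. 1) \<le> 1"
proof (induction n arbitrary: C)
  case (Suc n)
  have "(\<integral>\<^sup>+g. hit_within n (C #> g) (\<lambda>_. 1) \<partial>\<mu>) \<le> (\<integral>\<^sup>+g. 1 \<partial>\<mu>)"
    by (intro nn_integral_mono Suc.IH)
  then show ?case unfolding mu_const by simp
qed simp

text \<open>Minimum principle. The hitting probability \<open>u\<close> is harmonic off the subgroup
  and attains its minimum \<open>m\<close> since there are finitely many cosets. If
  \<open>m < 1\<close>, the minimum propagates along the walk and reaches the subgroup, where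
  \<open>u\<close> is 1.\<close>

lemma hit_one:
  assumes C: "C \<in> rcosets \<Gamma>"
  shows "hit C (\<lambda>_. 1) = 1"
proof -
  define u where "u = (\<lambda>C. hit C (\<lambda>_. 1))"
  define m where "m = Min (u ` (rcosets \<Gamma>))"
  have u_le: "u C \<le> 1" for C
    unfolding u_def hit_def by (rule SUP_least) (rule hit_within_one_le)
  have u_triv: "u \<Gamma> = 1"
    by (simp add: u_def hit_trivial_coset)
  have m_le: "m \<le> u C" if "C \<in> rcosets \<Gamma>" for C
    unfolding m_def using fin that by simp
  obtain C0 where C0: "C0 \<in> rcosets \<Gamma>" "u C0 = m"
    using Min_in[of "u ` (rcosets \<Gamma>)"] fin trivial_coset unfolding m_def by fastforce
  have "m = 1"
  proof (rule ccontr)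
    assume "m \<noteq> 1"
    then have m: "m < 1" using u_le C0 by (metis order.not_eq_order_implies_strict)
    have "u \<Gamma> = m"
    proof (rule coset_reachable[where Q = "\<lambda>C. u C = m", OF C0 trivial_coset])
      fix D g assume D: "D \<in> rcosets \<Gamma>" "u D = m" and g: "g \<in> set_pmf \<mu>"
      then have "D \<noteq> \<Gamma>" using u_triv m by auto
      then have um: "m = (\<integral>\<^sup>+g. u (D #> g) \<partial>\<mu>)"
        using D(2) hit_step[of D "\<lambda>_. 1"] unfolding u_def by simp
      \<comment> \<open>The average of \<open>u\<close> over the next coset is \<open>m\<close>
        while no value lies below \<open>m\<close>, so the nonnegative excess has mean 0 and
        vanishes at every support element.\<close>
      have ge: "AE g in \<mu>. m \<le> u (D #> g)"
        using m_le D translate_coset supp_carrier by (auto simp: AE_measure_pmf_iff)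
      have "(\<integral>\<^sup>+g. u (D #> g) - m \<partial>\<mu>) = (\<integral>\<^sup>+g. u (D #> g) \<partial>\<mu>) - (\<integral>\<^sup>+g. m \<partial>\<mu>)"
        using m ge unfolding mu_const
        by (subst nn_integral_diff) (auto simp: mu_const top_unique)
      also have "\<dots> = 0"
        unfolding um[symmetric] mu_const using order.strict_trans[OF m ennreal_one_less_top]
        by (simp add: diff_eq_0_iff_ennreal)
      finally have "AE g in \<mu>. u (D #> g) - m = 0"
        by (simp add: nn_integral_0_iff_AE)
      then have "u (D #> g) - m = 0" using g by (simp add: AE_measure_pmf_iff)
      then have "u (D #> g) \<le> m" by (metis diff_eq_0_iff_ennreal m order.strict_trans ennreal_one_less_top linorder_not_less order_le_less)
      then show "u (D #> g) = m"
        using ge g by (auto simp: AE_measure_pmf_iff)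
    qed
    then show False using u_triv m by simp
  qed
  then show ?thesis using m_le[OF C] u_le[of C] unfolding u_def by simp
qed

text \<open>The expectation of \<open>min \<sigma> n\<close> for the walk started at \<open>C\<close>.\<close>

primrec hit_time :: "nat \<Rightarrow> 'g set \<Rightarrow> ennreal" where
  "hit_time 0 C = 0"
| "hit_time (Suc n) C = (if C = \<Gamma> then 0 else 1 + (\<integral>\<^sup>+g. hit_time n (C #> g) \<partial>\<mu>))"

lemma hit_time_Suc_ge: "hit_time n C \<le> hit_time (Suc n) C"
proof (induction n arbitrary: C)
  case (Suc n)
  have "(\<integral>\<^sup>+g. hit_time n (C #> g) \<partial>\<mu>) \<le> (\<integral>\<^sup>+g. hit_time (Suc n) (C #> g) \<partial>\<mu>)"
    by (intro nn_integral_mono Suc.IH)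
  then show ?case by (simp add: add_left_mono)
qed simp

lemma hit_time_finite: "hit_time n C < \<infinity>"
proof -
  have "hit_time n C \<le> of_nat n"
  proof (induction n arbitrary: C)
    case (Suc n)
    have "(\<integral>\<^sup>+g. hit_time n (C #> g) \<partial>\<mu>) \<le> (\<integral>\<^sup>+g. of_nat n \<partial>\<mu>)"
      by (intro nn_integral_mono Suc.IH)
    then show ?case unfolding mu_const by (simp add: add_left_mono)
  qed simp
  then show ?thesis by (rule le_less_trans) (simp add: of_nat_less_top)
qed

text \<open>Kac's argument: right multiplication permutes the cosets, so counting measure is
  stationary for the coset walk.\<close>

lemma return_time_le_index:
  "1 + (\<integral>\<^sup>+g. hit_time n (\<Gamma> #> g) \<partial>\<mu>) \<le> of_nat (card (rcosets \<Gamma>))"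
proof -
  let ?S = "rcosets \<Gamma>" and ?P = "\<lambda>C. 1 + (\<integral>\<^sup>+g. hit_time n (C #> g) \<partial>\<mu>)"
  let ?T = "\<Sum>C\<in>?S. hit_time n C"
  \<comment> \<open>Truncating the time at \<open>n\<close> keeps this sum finite, so that it can be
    cancelled at the end.\<close>
  have T: "?T < \<infinity>"
    using hit_time_finite by (simp add: fin)
  have "?P \<Gamma> + ?T \<le> ?P \<Gamma> + (\<Sum>C\<in>?S. hit_time (Suc n) C)"
    by (intro add_left_mono sum_mono hit_time_Suc_ge)
  also have "\<dots> = ?P \<Gamma> + (\<Sum>C\<in>?S - {\<Gamma>}. hit_time (Suc n) C)"
    using sum.remove[OF fin trivial_coset, of "hit_time (Suc n)"] by simp
  also have "\<dots> = ?P \<Gamma> + (\<Sum>C\<in>?S - {\<Gamma>}. ?P C)"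
    by (intro arg_cong2[where f = "(+)"] sum.cong) auto
  also have "\<dots> = (\<Sum>C\<in>?S. ?P C)"
    using sum.remove[OF fin trivial_coset, of ?P] by simp
  also have "\<dots> = of_nat (card ?S) + ?T"
    by (simp add: sum.distrib sum_step)
  finally show ?thesis
    using T by (metis ennreal_add_left_cancel_le add.commute infinity_ennreal_def less_irrefl)
qed

end

section \<open>The information cocycle of a stationary action\<close>

text \<open>Bounds on the product suffice: since 0 times infinity is 0 in \<open>ennreal\<close>,
  neither factor can be 0 or infinite.\<close>

lemma ln_enn2real_mult:
  assumes "0 < a * b" "a * b < \<infinity>"
  shows "ln (enn2real (a * b)) = ln (enn2real a) + ln (enn2real b)"
proof -
  have "a \<noteq> 0" "b \<noteq> 0" "a \<noteq> \<infinity>" "b \<noteq> \<infinity>"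
    using assms by (auto simp: ennreal_top_mult ennreal_mult_top split: if_splits)
  then have "0 < enn2real a" "0 < enn2real b"
    by (simp_all add: enn2real_positive_iff zero_less_iff_neq_zero less_top)
  then show ?thesis by (simp add: enn2real_mult ln_mult)
qed

locale stationary_action = group G for G :: "('g, 'b) monoid_scheme" (structure) +
  fixes \<mu> :: "'g pmf" and act :: "'g \<Rightarrow> 'x \<Rightarrow> 'x" and \<nu> :: "'x measure"
  assumes supp: "set_pmf \<mu> \<subseteq> carrier G"
    and gen: "generating G \<mu>"
    and stat: "stationary_space G \<mu> act \<nu>"
begin

sublocale nu: prob_space \<nu>
  using stat by (simp add: stationary_space_def)

section \<open>The action and stationarity for integrals\<close>

lemma action: "group_action G (space \<nu>) act"
  using stat by (simp add: stationary_space_def measurable_action_def)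

lemma act_space: "g \<in> carrier G \<Longrightarrow> x \<in> space \<nu> \<Longrightarrow> act g x \<in> space \<nu>"
  using group_action.element_image[OF action] by blast

lemma act_mult:
  "g \<in> carrier G \<Longrightarrow> h \<in> carrier G \<Longrightarrow> x \<in> space \<nu> \<Longrightarrow> act (g \<otimes> h) x = act g (act h x)"
  using group_action.composition_rule[OF action] by blast

lemma act_one: "x \<in> space \<nu> \<Longrightarrow> act \<one> x = x"
  using group_action.id_eq_one[OF action] by (metis restrict_apply')

lemma act_inv:
  assumes "g \<in> carrier G" "x \<in> space \<nu>"
  shows "act (inv g) (act g x) = x" "act g (act (inv g) x) = x"
  using assms by (simp_all add: act_mult[symmetric] act_one)

lemma act_measurable:
  assumes g: "g \<in> carrier G"
  shows "act g \<in> measurable \<nu> \<nu>"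
proof -
  have "(\<lambda>(g, x). act g x) \<in> measurable (count_space (carrier G) \<Otimes>\<^sub>M \<nu>) \<nu>"
    using stat by (simp add: stationary_space_def measurable_action_def)
  moreover have "Pair g \<in> measurable \<nu> (count_space (carrier G) \<Otimes>\<^sub>M \<nu>)"
    using g by simp
  ultimately have "(\<lambda>(g, x). act g x) \<circ> Pair g \<in> measurable \<nu> \<nu>"
    by (rule measurable_comp[rotated])
  then show ?thesis by (simp add: comp_def)
qed

lemma measurable_act [measurable (raw)]:
  "g \<in> carrier G \<Longrightarrow> F \<in> borel_measurable \<nu> \<Longrightarrow> (\<lambda>x. F (act g x)) \<in> borel_measurable \<nu>"
  by (rule measurable_compose[OF act_measurable])

lemma AE_act_mu: "AE g in \<mu>. g \<in> carrier G"
  using supp by (auto simp: AE_measure_pmf_iff)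

lemma nn_integral_translate:
  assumes "g \<in> carrier G" "F \<in> borel_measurable \<nu>"
  shows "(\<integral>\<^sup>+x. F x \<partial>translate act g \<nu>) = (\<integral>\<^sup>+x. F (act g x) \<partial>\<nu>)"
  unfolding translate_def using assms by (simp add: nn_integral_distr act_measurable)

text \<open>Stationarity is defined on sets; indicators, linearity and monotone limits carry it to
  nonnegative functions.\<close>

lemma stationary_nn_integral:
  fixes F :: "'x \<Rightarrow> ennreal"
  assumes "F \<in> borel_measurable \<nu>"
  shows "(\<integral>\<^sup>+g. \<integral>\<^sup>+x. F (act g x) \<partial>\<nu> \<partial>\<mu>) = (\<integral>\<^sup>+x. F x \<partial>\<nu>)"
  using assms
proof (induction rule: borel_measurable_induct)
  case (cong f g)
  have "(\<integral>\<^sup>+g'. \<integral>\<^sup>+x. f (act g' x) \<partial>\<nu> \<partial>\<mu>) = (\<integral>\<^sup>+g'. \<integral>\<^sup>+x. g (act g' x) \<partial>\<nu> \<partial>\<mu>)"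
    using AE_act_mu cong act_space
    by (intro nn_integral_cong_AE) (auto intro!: nn_integral_cong)
  then show ?case using cong by (simp cong: nn_integral_cong)
next
  case (set A)
  have "(\<integral>\<^sup>+g. \<integral>\<^sup>+x. indicator A (act g x) \<partial>\<nu> \<partial>\<mu>) = (\<integral>\<^sup>+g. emeasure (translate act g \<nu>) A \<partial>\<mu>)"
  proof (rule nn_integral_cong_AE, use AE_act_mu in eventually_elim)
    fix g assume g: "g \<in> carrier G"
    have "(\<integral>\<^sup>+x. indicator A (act g x) \<partial>\<nu>) = (\<integral>\<^sup>+x. indicator A x \<partial>translate act g \<nu>)"
      using g set by (subst nn_integral_translate) auto
    then show "(\<integral>\<^sup>+x. indicator A (act g x) \<partial>\<nu>) = emeasure (translate act g \<nu>) A"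
      using set by (simp add: translate_def)
  qed
  also have "\<dots> = (\<integral>\<^sup>+g. ennreal (pmf \<mu> g) * emeasure (translate act g \<nu>) A \<partial>count_space UNIV)"
    by (rule nn_integral_measure_pmf)
  also have "\<dots> = (\<integral>\<^sup>+g. ennreal (pmf \<mu> g) * emeasure (translate act g \<nu>) A \<partial>count_space (carrier G))"
    using supp by (intro nn_integral_count_space_eq) (auto simp: pmf_eq_0_set_pmf)
  also have "\<dots> = emeasure \<nu> A"
    using stat set by (simp add: stationary_space_def)
  finally show ?case using set by simp
next
  case (mult u c)
  have "(\<integral>\<^sup>+g. \<integral>\<^sup>+x. c * u (act g x) \<partial>\<nu> \<partial>\<mu>) = (\<integral>\<^sup>+g. c * \<integral>\<^sup>+x. u (act g x) \<partial>\<nu> \<partial>\<mu>)"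
    using AE_act_mu mult by (intro nn_integral_cong_AE) (auto simp: nn_integral_cmult)
  then show ?case using mult by (simp add: nn_integral_cmult)
next
  case (add u v)
  have "(\<integral>\<^sup>+g. \<integral>\<^sup>+x. v (act g x) + u (act g x) \<partial>\<nu> \<partial>\<mu>)
      = (\<integral>\<^sup>+g. (\<integral>\<^sup>+x. v (act g x) \<partial>\<nu>) + (\<integral>\<^sup>+x. u (act g x) \<partial>\<nu>) \<partial>\<mu>)"
    using AE_act_mu add by (intro nn_integral_cong_AE) (auto simp: nn_integral_add)
  then show ?case using add by (simp add: nn_integral_add)
next
  case (seq U)
  have "(\<integral>\<^sup>+g. \<integral>\<^sup>+x. (SUP i. U i) (act g x) \<partial>\<nu> \<partial>\<mu>) = (\<integral>\<^sup>+g. (SUP i. \<integral>\<^sup>+x. U i (act g x) \<partial>\<nu>) \<partial>\<mu>)"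
    using AE_act_mu
  proof (intro nn_integral_cong_AE, eventually_elim)
    fix g assume g: "g \<in> carrier G"
    show "(\<integral>\<^sup>+x. (SUP i. U i) (act g x) \<partial>\<nu>) = (SUP i. \<integral>\<^sup>+x. U i (act g x) \<partial>\<nu>)"
      unfolding SUP_apply using seq g
      by (intro nn_integral_monotone_convergence_SUP) (auto simp: incseq_def le_fun_def)
  qed
  also have "\<dots> = (SUP i. \<integral>\<^sup>+g. \<integral>\<^sup>+x. U i (act g x) \<partial>\<nu> \<partial>\<mu>)"
    using seq by (intro nn_integral_monotone_convergence_SUP)
      (auto simp: incseq_def le_fun_def intro!: nn_integral_mono)
  also have "\<dots> = (SUP i. \<integral>\<^sup>+x. U i x \<partial>\<nu>)"
    using seq by simp
  also have "\<dots> = (\<integral>\<^sup>+x. (SUP i. U i) x \<partial>\<nu>)"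
    unfolding SUP_apply using seq by (intro nn_integral_monotone_convergence_SUP[symmetric]) auto
  finally show ?case .
qed

text \<open>For a support element \<open>s\<close>, one summand of the stationarity equation gives
  the constant \<open>pmf \<mu> s\<close>. Constants multiply along products, and the support
  generates the group. Quantifying over functions instead of sets lets the bound be
  iterated.\<close>

lemma translate_dominated:
  assumes "g \<in> carrier G"
  shows "\<exists>c>0. \<forall>F\<in>borel_measurable \<nu>. ennreal c * (\<integral>\<^sup>+x. F (act g x) \<partial>\<nu>) \<le> (\<integral>\<^sup>+x. F x \<partial>\<nu>)"
proof -
  have "g \<in> semigroup_generated G (set_pmf \<mu>)"
    using assms gen by (simp add: generating_def)
  then show ?thesis
  proof (induction rule: semigroup_generated.induct)
    case (incl s)
    have "ennreal (pmf \<mu> s) * (\<integral>\<^sup>+x. F (act s x) \<partial>\<nu>) \<le> (\<integral>\<^sup>+x. F x \<partial>\<nu>)"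
      if F: "F \<in> borel_measurable \<nu>" for F :: "'x \<Rightarrow> ennreal"
    proof -
      have "ennreal (pmf \<mu> s) * (\<integral>\<^sup>+x. F (act s x) \<partial>\<nu>)
          = (\<integral>\<^sup>+g. (\<integral>\<^sup>+x. F (act s x) \<partial>\<nu>) * indicator {s} g \<partial>\<mu>)"
        by (subst nn_integral_cmult_indicator) (simp_all add: emeasure_pmf_single mult.commute)
      also have "\<dots> \<le> (\<integral>\<^sup>+g. \<integral>\<^sup>+x. F (act g x) \<partial>\<nu> \<partial>\<mu>)"
        by (intro nn_integral_mono) (auto split: split_indicator)
      finally show ?thesis using stationary_nn_integral[OF F] by simp
    qed
    then show ?case using incl by (auto intro!: exI[of _ "pmf \<mu> s"] simp: pmf_positive)
  next
    case (mult a b)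
    have ab: "a \<in> carrier G" "b \<in> carrier G"
      using mult.hyps gen by (auto simp: generating_def)
    obtain c d where c: "c > 0" "\<And>F. F \<in> borel_measurable \<nu> \<Longrightarrow>
          ennreal c * (\<integral>\<^sup>+x. F (act a x) \<partial>\<nu>) \<le> (\<integral>\<^sup>+x. F x \<partial>\<nu>)"
      and d: "d > 0" "\<And>F. F \<in> borel_measurable \<nu> \<Longrightarrow>
          ennreal d * (\<integral>\<^sup>+x. F (act b x) \<partial>\<nu>) \<le> (\<integral>\<^sup>+x. F x \<partial>\<nu>)"
      using mult.IH by blast
    have "ennreal (c * d) * (\<integral>\<^sup>+x. F (act (a \<otimes> b) x) \<partial>\<nu>) \<le> (\<integral>\<^sup>+x. F x \<partial>\<nu>)"
      if F: "F \<in> borel_measurable \<nu>" for F :: "'x \<Rightarrow> ennreal"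
    proof -
      have "ennreal (c * d) * (\<integral>\<^sup>+x. F (act (a \<otimes> b) x) \<partial>\<nu>)
          = ennreal c * (ennreal d * (\<integral>\<^sup>+x. F (act a (act b x)) \<partial>\<nu>))"
        using c d ab by (simp add: ennreal_mult mult.assoc act_mult cong: nn_integral_cong)
      also have "\<dots> \<le> ennreal c * (\<integral>\<^sup>+x. F (act a x) \<partial>\<nu>)"
        using F ab by (intro mult_left_mono d(2)) auto
      also have "\<dots> \<le> (\<integral>\<^sup>+x. F x \<partial>\<nu>)"
        by (rule c(2)[OF F])
      finally show ?thesis .
    qed
    then show ?case using c d by (intro exI[of _ "c * d"]) auto
  qed
qed

section \<open>The Radon-Nikodym cocycle and its integrability\<close>

definition RN :: "'g \<Rightarrow> 'x \<Rightarrow> ennreal" where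
  "RN g = RN_deriv \<nu> (translate act (inv g) \<nu>)"

text \<open>This is the cocycle l of the overview. The conventions for \<open>enn2real\<close> and
  \<open>ln\<close> at 0 and infinity matter only on a null set, by
  \<open>RN_pos_finite\<close>.\<close>

definition info :: "'g \<Rightarrow> 'x \<Rightarrow> real" where
  "info g x = - ln (enn2real (RN g x))"

lemma measurable_RN [measurable]: "RN g \<in> borel_measurable \<nu>"
  unfolding RN_def by simp

lemma measurable_info [measurable]: "info g \<in> borel_measurable \<nu>"
  unfolding info_def by measurable

lemma density_RN:
  assumes g: "g \<in> carrier G"
  shows "density \<nu> (RN g) = translate act (inv g) \<nu>"
  unfolding RN_def
proof (rule nu.density_RN_deriv)
  obtain c where c: "c > 0" "\<forall>F\<in>borel_measurable \<nu>.
      ennreal c * (\<integral>\<^sup>+x. F (act (inv g) x) \<partial>\<nu>) \<le> (\<integral>\<^sup>+x. F x \<partial>\<nu>)"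
    using translate_dominated[of "inv g"] g by auto
  show "absolutely_continuous \<nu> (translate act (inv g) \<nu>)"
    unfolding absolutely_continuous_def
  proof
    fix A assume A: "A \<in> null_sets \<nu>"
    then have A': "A \<in> sets \<nu>" by auto
    have "emeasure (translate act (inv g) \<nu>) A = (\<integral>\<^sup>+x. indicator A x \<partial>translate act (inv g) \<nu>)"
      using A' by (simp add: translate_def)
    also have "\<dots> = (\<integral>\<^sup>+x. indicator A (act (inv g) x) \<partial>\<nu>)"
      using A' g by (intro nn_integral_translate) auto
    finally have "ennreal c * emeasure (translate act (inv g) \<nu>) A \<le> emeasure \<nu> A"
      using bspec[OF c(2), of "indicator A"] A' by simp
    also have "emeasure \<nu> A = 0" using A by auto
    finally show "A \<in> null_sets (translate act (inv g) \<nu>)"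
      using c A' by (auto simp: translate_def)
  qed
qed (simp add: translate_def)

lemma nn_integral_RN:
  assumes "g \<in> carrier G" and [measurable]: "F \<in> borel_measurable \<nu>"
  shows "(\<integral>\<^sup>+x. RN g x * F x \<partial>\<nu>) = (\<integral>\<^sup>+x. F (act (inv g) x) \<partial>\<nu>)"
proof -
  have "(\<integral>\<^sup>+x. RN g x * F x \<partial>\<nu>) = (\<integral>\<^sup>+x. F x \<partial>density \<nu> (RN g))"
    by (simp add: nn_integral_density)
  then show ?thesis using assms by (simp add: density_RN nn_integral_translate)
qed

text \<open>Chain rule for densities: both sides integrate indicators like the translate of the
  measure by the inverse of \<open>g \<otimes> h\<close>, so uniqueness of the density
  applies.\<close>

lemma RN_mult:
  assumes g: "g \<in> carrier G" and h: "h \<in> carrier G"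
  shows "AE x in \<nu>. RN (g \<otimes> h) x = RN g (act h x) * RN h x"
proof -
  have "density \<nu> (\<lambda>x. RN g (act h x) * RN h x) = translate act (inv (g \<otimes> h)) \<nu>"
  proof (rule measure_eqI)
    fix A assume "A \<in> sets (density \<nu> (\<lambda>x. RN g (act h x) * RN h x))"
    then have A [measurable]: "A \<in> sets \<nu>" by simp
    note [measurable] = measurable_act[OF h measurable_RN] 
    have "emeasure (density \<nu> (\<lambda>x. RN g (act h x) * RN h x)) A
        = (\<integral>\<^sup>+x. RN h x * (RN g (act h x) * indicator A x) \<partial>\<nu>)"
      by (subst emeasure_density) (auto simp: mult_ac)
    also have "\<dots> = (\<integral>\<^sup>+x. RN g (act h (act (inv h) x)) * indicator A (act (inv h) x) \<partial>\<nu>)"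
      by (rule nn_integral_RN[OF h]) measurable
    also have "\<dots> = (\<integral>\<^sup>+x. RN g x * indicator A (act (inv h) x) \<partial>\<nu>)"
      using h by (intro nn_integral_cong) (simp add: act_inv)
    also have "\<dots> = (\<integral>\<^sup>+x. indicator A (act (inv h) (act (inv g) x)) \<partial>\<nu>)"
      using h by (intro nn_integral_RN[OF g]) auto
    also have "\<dots> = (\<integral>\<^sup>+x. indicator A (act (inv (g \<otimes> h)) x) \<partial>\<nu>)"
      using g h by (intro nn_integral_cong) (simp add: inv_mult_group act_mult)
    also have "\<dots> = (\<integral>\<^sup>+x. indicator A x \<partial>translate act (inv (g \<otimes> h)) \<nu>)"
      using g h by (intro nn_integral_translate[symmetric]) auto
    also have "\<dots> = emeasure (translate act (inv (g \<otimes> h)) \<nu>) A"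
      by (simp add: translate_def)
    finally show "emeasure (density \<nu> (\<lambda>x. RN g (act h x) * RN h x)) A = \<dots>" .
  qed (simp add: translate_def)
  then have "AE x in \<nu>. RN g (act h x) * RN h x = RN (g \<otimes> h) x"
    unfolding RN_def[of "g \<otimes> h"] using h by (intro nu.RN_deriv_unique) auto
  then show ?thesis by eventually_elim simp
qed

lemma RN_one: "AE x in \<nu>. RN \<one> x = 1"
proof -
  have "translate act (inv \<one>) \<nu> = distr \<nu> \<nu> (\<lambda>x. x)"
    unfolding translate_def by (intro distr_cong) (auto simp: act_one)
  then have "density \<nu> (\<lambda>_. 1) = translate act (inv \<one>) \<nu>"
    by (simp add: density_1)
  then have "AE x in \<nu>. 1 = RN \<one> x"
    unfolding RN_def by (intro nu.RN_deriv_unique) auto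
  then show ?thesis by eventually_elim simp
qed

lemma RN_inv:
  assumes g: "g \<in> carrier G"
  shows "AE x in \<nu>. RN (inv g) (act g x) * RN g x = 1"
  using RN_mult[of "inv g" g] RN_one g by auto

text \<open>A product equal to 1 in \<open>ennreal\<close> has no factor 0 or infinity.\<close>

lemma RN_pos_finite:
  assumes g: "g \<in> carrier G"
  shows "AE x in \<nu>. 0 < RN g x \<and> RN g x < \<infinity>"
  using RN_inv[OF g]
proof eventually_elim
  case (elim x)
  then have "RN g x \<noteq> 0" "RN (inv g) (act g x) \<noteq> 0" by auto
  moreover from this elim have "RN g x \<noteq> \<infinity>" by (auto simp: ennreal_mult_eq_top_iff)
  ultimately show ?case by (simp add: zero_less_iff_neq_zero less_top)
qed

lemma info_mult:
  assumes g: "g \<in> carrier G" and h: "h \<in> carrier G"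
  shows "AE x in \<nu>. info (g \<otimes> h) x = info g (act h x) + info h x"
  using RN_mult[OF g h] RN_pos_finite[OF m_closed[OF g h]]
  by eventually_elim (simp add: info_def ln_enn2real_mult)

lemma info_one: "AE x in \<nu>. info \<one> x = 0"
  using RN_one by eventually_elim (simp add: info_def)

lemma info_inv:
  assumes g: "g \<in> carrier G"
  shows "AE x in \<nu>. info g x = - info (inv g) (act g x)"
  using info_mult[of "inv g" g] info_one g by auto

text \<open>This is ln r <= r for a density value r. If r is 0 or infinite, its real part is 0 and,
  as \<open>ln 0 = 0\<close>, the left side is 0.\<close>

lemma info_neg_le_RN: "ennreal (- info g x) \<le> RN g x"
proof (cases "0 < enn2real (RN g x)")
  case True
  then have "RN g x < \<infinity>" by (simp add: enn2real_positive_iff)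
  then have "ennreal (enn2real (RN g x)) = RN g x" by simp
  moreover have "ln (enn2real (RN g x)) \<le> enn2real (RN g x)"
    using ln_bound[OF True] by simp
  ultimately show ?thesis
    unfolding info_def by (metis ennreal_leI minus_minus)
next
  case False
  then have "enn2real (RN g x) = 0" by (simp add: order.antisym)
  then show ?thesis by (simp add: info_def)
qed

lemma nn_integral_RN_eq_1: "g \<in> carrier G \<Longrightarrow> (\<integral>\<^sup>+x. RN g x \<partial>\<nu>) = 1"
  using nn_integral_RN[of g "\<lambda>_. 1"] nu.emeasure_space_1 by simp

lemma info_neg_le_1: "g \<in> carrier G \<Longrightarrow> (\<integral>\<^sup>+x. ennreal (- info g x) \<partial>\<nu>) \<le> 1"
  using nn_integral_mono[of \<nu> "\<lambda>x. ennreal (- info g x)" "RN g"] info_neg_le_RN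
  by (simp add: nn_integral_RN_eq_1)

text \<open>The positive part for \<open>g\<close> is the negative part for \<open>inv g\<close>
  evaluated at \<open>act g x\<close>; domination of the translate then bounds its integral by
  1/c.\<close>

lemma info_pos_finite:
  assumes g: "g \<in> carrier G"
  shows "(\<integral>\<^sup>+x. ennreal (info g x) \<partial>\<nu>) < \<infinity>"
proof -
  obtain c where c: "c > 0" "\<forall>F\<in>borel_measurable \<nu>.
      ennreal c * (\<integral>\<^sup>+x. F (act g x) \<partial>\<nu>) \<le> (\<integral>\<^sup>+x. F x \<partial>\<nu>)"
    using translate_dominated[OF g] by auto
  have "(\<integral>\<^sup>+x. ennreal (info g x) \<partial>\<nu>) = (\<integral>\<^sup>+x. ennreal (- info (inv g) (act g x)) \<partial>\<nu>)"
    using info_inv[OF g] by (intro nn_integral_cong_AE) auto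
  then have "ennreal c * (\<integral>\<^sup>+x. ennreal (info g x) \<partial>\<nu>) \<le> (\<integral>\<^sup>+x. ennreal (- info (inv g) x) \<partial>\<nu>)"
    using bspec[OF c(2), of "\<lambda>x. ennreal (- info (inv g) x)"] by simp
  also have "\<dots> \<le> 1" using info_neg_le_1 g by simp
  finally show ?thesis
    using c(1) by (cases "(\<integral>\<^sup>+x. ennreal (info g x) \<partial>\<nu>) = \<infinity>") (auto simp: less_top ennreal_mult_top top_unique)
qed

lemma integrable_info:
  assumes g: "g \<in> carrier G"
  shows "integrable \<nu> (info g)"
proof -
  have "(\<integral>\<^sup>+x. ennreal (- info g x) \<partial>\<nu>) < \<infinity>"
    using info_neg_le_1[OF g] by (rule le_less_trans) simp
  then show ?thesis
    using info_pos_finite[OF g] by (simp add: real_integrable_def less_top)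
qed

section \<open>The integrated cocycle\<close>

definition phi :: "'g \<Rightarrow> real" where
  "phi g = (\<integral>x. info g x \<partial>\<nu>)"

lemma rn_information_eq: "rn_information G act \<nu> = phi"
  by (simp add: fun_eq_iff rn_information_def phi_def info_def RN_def)

text \<open>Jensen's inequality in the form -ln r >= 1 - r, whose right side integrates to
  0.\<close>

lemma phi_nonneg:
  assumes g: "g \<in> carrier G"
  shows "0 \<le> phi g"
proof -
  let ?r = "\<lambda>x. enn2real (RN g x)"
  have r: "(\<integral>\<^sup>+x. ennreal (?r x) \<partial>\<nu>) = 1"
    using RN_pos_finite[OF g] nn_integral_RN_eq_1[OF g]
    by (subst nn_integral_cong_AE[where v = "RN g"]) auto
  have int: "integrable \<nu> ?r"
    by (rule integrableI_nn_integral_finite[where x = 1]) (use r in auto)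
  have "(\<integral>x. ?r x \<partial>\<nu>) = 1"
    by (subst integral_eq_nn_integral) (use r in auto)
  then have "0 = (\<integral>x. 1 - ?r x \<partial>\<nu>)"
    using int nu.prob_space by simp
  also have "\<dots> \<le> (\<integral>x. info g x \<partial>\<nu>)"
  proof (rule integral_mono_AE)
    show "AE x in \<nu>. 1 - ?r x \<le> info g x"
      using RN_pos_finite[OF g]
    proof eventually_elim
      case (elim x)
      then have "0 < ?r x" by (simp add: enn2real_positive_iff)
      then show ?case using ln_le_minus_one[of "?r x"] by (simp add: info_def)
    qed
  qed (use int integrable_info[OF g] in auto)
  finally show ?thesis by (simp add: phi_def)
qed

lemma phi_one: "phi \<one> = 0"
  using info_one unfolding phi_def by (subst integral_cong_AE[where g = "\<lambda>_. 0"]) auto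

text \<open>The integrated cocycle identity, arranged so that no subtraction occurs.\<close>

lemma phi_mult:
  assumes g: "g \<in> carrier G" and h: "h \<in> carrier G"
  shows "ennreal (phi (g \<otimes> h)) + (\<integral>\<^sup>+x. ennreal (- info g (act h x)) \<partial>\<nu>)
       = ennreal (phi h) + (\<integral>\<^sup>+x. ennreal (info g (act h x)) \<partial>\<nu>)"
proof -
  note [measurable] = measurable_act[OF h measurable_info]
  let ?k = "\<lambda>x. info g (act h x)"
  have ae: "AE x in \<nu>. info (g \<otimes> h) x - info h x = ?k x"
    using info_mult[OF g h] by auto
  have int: "integrable \<nu> ?k"
    by (rule integrable_cong_AE_imp[OF Bochner_Integration.integrable_diff[OF
          integrable_info[OF m_closed[OF g h]] integrable_info[OF h]] _ ae]) measurable
  have "phi (g \<otimes> h) - phi h = (\<integral>x. ?k x \<partial>\<nu>)"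
    using ae g h unfolding phi_def
    by (subst Bochner_Integration.integral_diff[symmetric]) (auto intro!: integral_cong_AE integrable_info)
  also have "\<dots> = enn2real (\<integral>\<^sup>+x. ennreal (?k x) \<partial>\<nu>) - enn2real (\<integral>\<^sup>+x. ennreal (- ?k x) \<partial>\<nu>)"
    by (rule real_lebesgue_integral_def[OF int])
  finally have "phi (g \<otimes> h) + enn2real (\<integral>\<^sup>+x. ennreal (- ?k x) \<partial>\<nu>)
      = phi h + enn2real (\<integral>\<^sup>+x. ennreal (?k x) \<partial>\<nu>)"
    by simp
  then have "ennreal (phi (g \<otimes> h)) + ennreal (enn2real (\<integral>\<^sup>+x. ennreal (- ?k x) \<partial>\<nu>))
      = ennreal (phi h) + ennreal (enn2real (\<integral>\<^sup>+x. ennreal (?k x) \<partial>\<nu>))"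
    using phi_nonneg g h by (simp add: ennreal_plus[symmetric] del: ennreal_plus)
  moreover have "(\<integral>\<^sup>+x. ennreal (- ?k x) \<partial>\<nu>) < \<infinity>" "(\<integral>\<^sup>+x. ennreal (?k x) \<partial>\<nu>) < \<infinity>"
    using int by (auto simp: real_integrable_def less_top)
  ultimately show ?thesis by simp
qed

lemma phi_add_neg:
  assumes g: "g \<in> carrier G"
  shows "ennreal (phi g) + (\<integral>\<^sup>+x. ennreal (- info g x) \<partial>\<nu>) = (\<integral>\<^sup>+x. ennreal (info g x) \<partial>\<nu>)"
  using phi_mult[OF g one_closed] g by (simp add: phi_one act_one cong: nn_integral_cong)

end

section \<open>Optional stopping and summation over cosets\<close>

locale stationary_walk =
  finite_index_walk G \<mu> \<Gamma> + stationary_action G \<mu> act \<nu>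
  for G :: "('g, 'b) monoid_scheme" (structure) and \<mu> \<Gamma> and act :: "'g \<Rightarrow> 'x \<Rightarrow> 'x" and \<nu>
begin

text \<open>The half of optional stopping that holds at every truncation: paths not yet stopped
  contribute 0, hence an inequality. A step \<open>g\<close> replaces \<open>F\<close> by its
  composition with \<open>act g\<close>, so the induction runs over all \<open>F\<close>, and
  stationarity closes it.\<close>

lemma hit_within_orbit_le:
  assumes "F \<in> borel_measurable \<nu>"
  shows "hit_within n C (\<lambda>h. \<integral>\<^sup>+x. F (act h x) \<partial>\<nu>) \<le> (\<integral>\<^sup>+x. F x \<partial>\<nu>)"
  using assms
proof (induction n arbitrary: C F)
  case (Suc n)
  show ?case
  proof (cases "C = \<Gamma>")
    case True
    then show ?thesis by (simp add: act_one cong: nn_integral_cong)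
  next
    case False
    have "hit_within n (C #> g) (\<lambda>h. \<integral>\<^sup>+x. F (act (g \<otimes> h) x) \<partial>\<nu>) \<le> (\<integral>\<^sup>+x. F (act g x) \<partial>\<nu>)"
      if g: "g \<in> set_pmf \<mu>" for g
    proof -
      have "hit_within n (C #> g) (\<lambda>h. \<integral>\<^sup>+x. F (act (g \<otimes> h) x) \<partial>\<nu>)
          = hit_within n (C #> g) (\<lambda>h. \<integral>\<^sup>+x. F (act g (act h x)) \<partial>\<nu>)"
        using supp_carrier[OF g] by (intro hit_within_cong nn_integral_cong) (simp add: act_mult)
      also have "\<dots> \<le> (\<integral>\<^sup>+x. F (act g x) \<partial>\<nu>)"
        using supp_carrier[OF g] Suc.prems by (intro Suc.IH) simp
      finally show ?thesis .
    qed
    then have "hit_within (Suc n) C (\<lambda>h. \<integral>\<^sup>+x. F (act h x) \<partial>\<nu>)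
        \<le> (\<integral>\<^sup>+g. \<integral>\<^sup>+x. F (act g x) \<partial>\<nu> \<partial>\<mu>)"
      using False by (auto intro!: mu_mono)
    then show ?thesis by (simp only: stationary_nn_integral[OF Suc.prems])
  qed
qed simp

lemma hit_orbit_le:
  "F \<in> borel_measurable \<nu> \<Longrightarrow> hit C (\<lambda>h. \<integral>\<^sup>+x. F (act h x) \<partial>\<nu>) \<le> (\<integral>\<^sup>+x. F x \<partial>\<nu>)"
  unfolding hit_def by (rule SUP_least) (rule hit_within_orbit_le)

text \<open>For \<open>F \<le> 1\<close>, the inequalities for \<open>F\<close> and \<open>1 - F\<close> add up to the equality
  \<open>hit C 1 = 1\<close>, so both are equalities.\<close>

lemma hit_orbit_bounded:
  assumes [measurable]: "F \<in> borel_measurable \<nu>" and F: "\<And>x. F x \<le> 1" and C: "C \<in> rcosets \<Gamma>"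
  shows "hit C (\<lambda>h. \<integral>\<^sup>+x. F (act h x) \<partial>\<nu>) = (\<integral>\<^sup>+x. F x \<partial>\<nu>)"
proof -
  let ?H = "\<lambda>F. hit C (\<lambda>h. \<integral>\<^sup>+x. F (act h x) \<partial>\<nu>)" and ?F' = "\<lambda>x. 1 - F x"
  have split: "F x + ?F' x = 1" for x
    using F[of x] by (simp add: add_diff_inverse_ennreal)
  have "?H F + ?H ?F' = hit C (\<lambda>_. 1)"
    unfolding hit_add[symmetric]
  proof (rule hit_cong)
    fix h assume h: "h \<in> carrier G"
    have "(\<integral>\<^sup>+x. F (act h x) \<partial>\<nu>) + (\<integral>\<^sup>+x. ?F' (act h x) \<partial>\<nu>) = (\<integral>\<^sup>+x. F (act h x) + ?F' (act h x) \<partial>\<nu>)"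
      using h by (intro nn_integral_add[symmetric] measurable_act) auto
    then show "(\<integral>\<^sup>+x. F (act h x) \<partial>\<nu>) + (\<integral>\<^sup>+x. ?F' (act h x) \<partial>\<nu>) = 1"
      by (simp add: split nu.emeasure_space_1)
  qed
  then have 1: "?H F + ?H ?F' = 1" by (simp add: hit_one[OF C])
  have 2: "(\<integral>\<^sup>+x. F x \<partial>\<nu>) + (\<integral>\<^sup>+x. ?F' x \<partial>\<nu>) = 1"
    by (subst nn_integral_add[symmetric]) (auto simp: split nu.emeasure_space_1)
  have le: "?H F \<le> (\<integral>\<^sup>+x. F x \<partial>\<nu>)" "?H ?F' \<le> (\<integral>\<^sup>+x. ?F' x \<partial>\<nu>)"
    by (rule hit_orbit_le; measurable)+
  have "?H ?F' \<le> 1" using 1 by (metis le_add_same_cancel2 zero_le add.commute le_iff_add)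
  then have fin: "?H ?F' \<noteq> \<infinity>" by (auto simp: top_unique)
  have "(\<integral>\<^sup>+x. F x \<partial>\<nu>) + ?H ?F' \<le> ?H F + ?H ?F'"
    using 1 2 le(2) by (metis add_left_mono)
  then show ?thesis
    using le(1) fin by (intro antisym) (auto simp: ennreal_add_left_cancel_le add.commute[of _ "?H ?F'"])
qed

text \<open>The bounded case extends by homogeneity to truncations of \<open>F\<close>, and monotone
  convergence gives the missing inequality.\<close>

lemma hit_orbit:
  assumes [measurable]: "F \<in> borel_measurable \<nu>" and C: "C \<in> rcosets \<Gamma>"
  shows "hit C (\<lambda>h. \<integral>\<^sup>+x. F (act h x) \<partial>\<nu>) = (\<integral>\<^sup>+x. F x \<partial>\<nu>)"
proof (rule antisym[OF hit_orbit_le])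
  \<comment> \<open>The height is \<open>Suc k\<close> so that division by it, which scales the
    truncation below 1, is legitimate for every \<open>k\<close>.\<close>
  define T where "T = (\<lambda>k x. min (F x) (of_nat (Suc k)))"
  have [measurable]: "T k \<in> borel_measurable \<nu>" for k
    unfolding T_def by measurable
  have T_le: "(\<integral>\<^sup>+x. T k x \<partial>\<nu>) \<le> hit C (\<lambda>h. \<integral>\<^sup>+x. F (act h x) \<partial>\<nu>)" for k
  proof -
    let ?c = "of_nat (Suc k) :: ennreal"
    define U where "U = (\<lambda>x. T k x / ?c)"
    have [measurable]: "U \<in> borel_measurable \<nu>"
      unfolding U_def by measurable
    have c: "?c \<noteq> 0" "?c \<noteq> \<top>" by (simp_all add: of_nat_less_top less_top[symmetric] del: of_nat_Suc)
    have TU: "T k x = ?c * U x" for x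
      unfolding U_def using c by (simp add: ennreal_times_divide mult_divide_eq_ennreal mult.commute)
    have "U x \<le> 1" for x
    proof -
      have "U x \<le> ?c / ?c"
        unfolding U_def T_def by (intro divide_right_mono_ennreal) simp
      then show ?thesis using ennreal_divide_self[OF c(1)] c(2) by (metis less_top)
    qed
    then have "(\<integral>\<^sup>+x. T k x \<partial>\<nu>) = ?c * hit C (\<lambda>h. \<integral>\<^sup>+x. U (act h x) \<partial>\<nu>)"
      using C unfolding TU by (simp add: nn_integral_cmult hit_orbit_bounded del: of_nat_Suc)
    also have "\<dots> = hit C (\<lambda>h. \<integral>\<^sup>+x. T k (act h x) \<partial>\<nu>)"
      unfolding hit_cmult[symmetric] TU by (intro hit_cong nn_integral_cmult[symmetric]) measurable
    also have "\<dots> \<le> hit C (\<lambda>h. \<integral>\<^sup>+x. F (act h x) \<partial>\<nu>)"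
      by (intro hit_mono nn_integral_mono) (simp add: T_def)
    finally show ?thesis .
  qed
  have sup: "(SUP k. T k x) = F x" for x
  proof (rule antisym)
    show "(SUP k. T k x) \<le> F x" by (rule SUP_least) (simp add: T_def)
    show "F x \<le> (SUP k. T k x)"
    proof (cases "F x = \<top>")
      case True
      have "(SUP k. T k x) = (SUP k. of_nat (Suc k))"
        by (simp add: T_def True min_def top_unique del: of_nat_Suc)
      also have "\<dots> \<ge> (SUP k. of_nat k :: ennreal)"
        by (rule SUP_mono') (simp add: of_nat_mono del: of_nat_Suc)
      finally show ?thesis by (simp only: ennreal_SUP_of_nat_eq_top True)
    next
      case False
      then obtain k where "F x < of_nat k"
        using ennreal_Ex_less_of_nat by (auto simp: less_top)
      also have "of_nat k \<le> (of_nat (Suc k) :: ennreal)"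
        by (rule of_nat_mono) simp
      finally have "F x = T k x"
        unfolding T_def by (simp add: min_absorb1 del: of_nat_Suc)
      then show ?thesis by (metis SUP_upper UNIV_I)
    qed
  qed
  have "(\<integral>\<^sup>+x. F x \<partial>\<nu>) = (\<integral>\<^sup>+x. (SUP k. T k x) \<partial>\<nu>)"
    by (simp add: sup)
  also have "\<dots> = (SUP k. \<integral>\<^sup>+x. T k x \<partial>\<nu>)"
    by (rule nn_integral_monotone_convergence_SUP)
      (auto simp: incseq_def le_fun_def T_def intro!: min.coboundedI2 of_nat_mono simp del: of_nat_Suc)
  also have "\<dots> \<le> hit C (\<lambda>h. \<integral>\<^sup>+x. F (act h x) \<partial>\<nu>)"
    by (rule SUP_least) (rule T_le)
  finally show "(\<integral>\<^sup>+x. F x \<partial>\<nu>) \<le> hit C (\<lambda>h. \<integral>\<^sup>+x. F (act h x) \<partial>\<nu>)" .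
qed measurable

section \<open>Entropy balance on the cosets\<close>

definition ent :: ennreal where "ent = (\<integral>\<^sup>+g. ennreal (phi g) \<partial>\<mu>)"
definition pos_info :: ennreal where "pos_info = (\<integral>\<^sup>+g. \<integral>\<^sup>+x. ennreal (info g x) \<partial>\<nu> \<partial>\<mu>)"
definition neg_info :: ennreal where "neg_info = (\<integral>\<^sup>+g. \<integral>\<^sup>+x. ennreal (- info g x) \<partial>\<nu> \<partial>\<mu>)"

lemma ent_add_neg: "ent + neg_info = pos_info"
  unfolding ent_def neg_info_def pos_info_def
  by (simp add: nn_integral_add[symmetric] phi_add_neg supp_carrier cong: mu_cong)

text \<open>This makes \<open>neg_info\<close> cancellable whenever it occurs on both sides of an
  equation.\<close>

lemma neg_finite: "neg_info < \<infinity>"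
proof -
  have "neg_info \<le> (\<integral>\<^sup>+g. 1 \<partial>\<mu>)"
    unfolding neg_info_def by (intro mu_mono info_neg_le_1 supp_carrier)
  then show ?thesis unfolding mu_const by (rule le_less_trans) simp
qed

text \<open>Stopping with a forced first step. Off the subgroup it agrees with \<open>hit\<close>;
  at the subgroup it is the expectation at the first return, that is, the integral against the
  hitting measure.\<close>

definition step_hit :: "'g set \<Rightarrow> ('g \<Rightarrow> ennreal) \<Rightarrow> ennreal" where
  "step_hit C f = (\<integral>\<^sup>+g. hit (C #> g) (\<lambda>h. f (g \<otimes> h)) \<partial>\<mu>)"

text \<open>The identity A(C) = h + (PA)(C) of the overview, with \<open>neg_info\<close> added to
  both sides and the left side read with a forced step, so that it also covers the subgroup
  itself.\<close>

lemma step_hit_phi: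
  assumes C: "C \<in> rcosets \<Gamma>"
  shows "step_hit C phi + neg_info = pos_info + (\<integral>\<^sup>+g. hit (C #> g) phi \<partial>\<mu>)"
proof -
  have "step_hit C phi + neg_info
      = (\<integral>\<^sup>+g. hit (C #> g) (\<lambda>h. phi (g \<otimes> h)) + (\<integral>\<^sup>+x. ennreal (- info g x) \<partial>\<nu>) \<partial>\<mu>)"
    unfolding step_hit_def neg_info_def by (simp add: nn_integral_add)
  also have "\<dots> = (\<integral>\<^sup>+g. hit (C #> g) phi + (\<integral>\<^sup>+x. ennreal (info g x) \<partial>\<nu>) \<partial>\<mu>)"
  proof (rule mu_cong)
    fix g assume "g \<in> set_pmf \<mu>"
    then have g: "g \<in> carrier G" by (rule supp_carrier)
    have D: "C #> g \<in> rcosets \<Gamma>" by (rule translate_coset[OF C g])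
    \<comment> \<open>Optional stopping, read backwards, turns the constant negative part into an
      average over the stopped product \<open>h\<close>, so the cocycle identity applies for each
      \<open>h\<close>; it then removes \<open>h\<close> from the positive part.\<close>
    have "hit (C #> g) (\<lambda>h. phi (g \<otimes> h)) + (\<integral>\<^sup>+x. ennreal (- info g x) \<partial>\<nu>)
        = hit (C #> g) (\<lambda>h. ennreal (phi (g \<otimes> h)) + (\<integral>\<^sup>+x. ennreal (- info g (act h x)) \<partial>\<nu>))"
      unfolding hit_add by (subst hit_orbit[OF _ D, where F = "\<lambda>x. ennreal (- info g x)"]) auto
    also have "\<dots> = hit (C #> g) (\<lambda>h. ennreal (phi h) + (\<integral>\<^sup>+x. ennreal (info g (act h x)) \<partial>\<nu>))"
      by (intro hit_cong phi_mult g)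
    also have "\<dots> = hit (C #> g) phi + (\<integral>\<^sup>+x. ennreal (info g x) \<partial>\<nu>)"
      unfolding hit_add by (subst hit_orbit[OF _ D, where F = "\<lambda>x. ennreal (info g x)"]) auto
    finally show "hit (C #> g) (\<lambda>h. phi (g \<otimes> h)) + (\<integral>\<^sup>+x. ennreal (- info g x) \<partial>\<nu>) = \<dots>" .
  qed
  also have "\<dots> = pos_info + (\<integral>\<^sup>+g. hit (C #> g) phi \<partial>\<mu>)"
    unfolding pos_info_def by (simp add: nn_integral_add add.commute)
  finally show ?thesis .
qed

text \<open>Before the limit, optional stopping is only an inequality; dropping the negative part
  leaves an upper bound, enough for an a priori estimate.\<close>

lemma step_hit_within_phi:
  "(\<integral>\<^sup>+g. hit_within n (C #> g) (\<lambda>h. phi (g \<otimes> h)) \<partial>\<mu>)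
       \<le> pos_info + (\<integral>\<^sup>+g. hit_within n (C #> g) phi \<partial>\<mu>)"
proof -
  have "(\<integral>\<^sup>+g. hit_within n (C #> g) (\<lambda>h. phi (g \<otimes> h)) \<partial>\<mu>)
      \<le> (\<integral>\<^sup>+g. hit_within n (C #> g) phi + (\<integral>\<^sup>+x. ennreal (info g x) \<partial>\<nu>) \<partial>\<mu>)"
  proof (rule mu_mono)
    fix g assume "g \<in> set_pmf \<mu>"
    then have g: "g \<in> carrier G" by (rule supp_carrier)
    have "hit_within n (C #> g) (\<lambda>h. phi (g \<otimes> h))
        \<le> hit_within n (C #> g) (\<lambda>h. ennreal (phi h) + (\<integral>\<^sup>+x. ennreal (info g (act h x)) \<partial>\<nu>))"
      by (intro hit_within_mono) (metis phi_mult[OF g] le_iff_add)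
    also have "\<dots> \<le> hit_within n (C #> g) phi + (\<integral>\<^sup>+x. ennreal (info g x) \<partial>\<nu>)"
      unfolding hit_within_add
      by (intro add_left_mono hit_within_orbit_le[where F = "\<lambda>x. ennreal (info g x)"]) auto
    finally show "hit_within n (C #> g) (\<lambda>h. phi (g \<otimes> h)) \<le> \<dots>" .
  qed
  then show ?thesis
    unfolding pos_info_def by (simp add: nn_integral_add add.commute)
qed

text \<open>A Wald-type bound: each step before stopping adds at most \<open>pos_info\<close> on
  average.\<close>

lemma hit_within_phi_le: "hit_within n C phi \<le> pos_info * hit_time n C"
proof (induction n arbitrary: C)
  case (Suc n)
  have "(\<integral>\<^sup>+g. hit_within n (C #> g) phi \<partial>\<mu>) \<le> (\<integral>\<^sup>+g. pos_info * hit_time n (C #> g) \<partial>\<mu>)"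
    by (intro nn_integral_mono Suc.IH)
  then have "(\<integral>\<^sup>+g. hit_within n (C #> g) (\<lambda>h. phi (g \<otimes> h)) \<partial>\<mu>)
      \<le> pos_info + pos_info * (\<integral>\<^sup>+g. hit_time n (C #> g) \<partial>\<mu>)"
    by (intro order_trans[OF step_hit_within_phi] add_left_mono)
      (simp add: nn_integral_cmult)
  then show ?case by (simp add: phi_one distrib_left)
qed simp

text \<open>The Wald-type bound after one forced step, combined with Kac's bound on the expected
  return time.\<close>

lemma step_hit_phi_le: "step_hit \<Gamma> phi \<le> pos_info * of_nat (card (rcosets \<Gamma>))"
  unfolding step_hit_def nn_integral_hit
proof (rule SUP_least)
  fix n
  have "(\<integral>\<^sup>+g. hit_within n (\<Gamma> #> g) phi \<partial>\<mu>) \<le> (\<integral>\<^sup>+g. pos_info * hit_time n (\<Gamma> #> g) \<partial>\<mu>)"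
    by (intro nn_integral_mono hit_within_phi_le)
  then have "(\<integral>\<^sup>+g. hit_within n (\<Gamma> #> g) (\<lambda>h. phi (g \<otimes> h)) \<partial>\<mu>)
      \<le> pos_info + pos_info * (\<integral>\<^sup>+g. hit_time n (\<Gamma> #> g) \<partial>\<mu>)"
    by (intro order_trans[OF step_hit_within_phi] add_left_mono)
      (simp add: nn_integral_cmult)
  also have "\<dots> = pos_info * (1 + (\<integral>\<^sup>+g. hit_time n (\<Gamma> #> g) \<partial>\<mu>))"
    by (simp add: distrib_left)
  also have "\<dots> \<le> pos_info * of_nat (card (rcosets \<Gamma>))"
    by (intro mult_left_mono return_time_le_index) simp
  finally show "(\<integral>\<^sup>+g. hit_within n (\<Gamma> #> g) (\<lambda>h. phi (g \<otimes> h)) \<partial>\<mu>) \<le> \<dots>" .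
qed

lemma hit_phi_trivial_coset: "hit \<Gamma> phi = 0"
  by (simp add: hit_trivial_coset phi_one)

text \<open>Finiteness spreads from the subgroup along the walk. At a coset with finite value the
  forced-step value is finite too, by the a priori bound at the subgroup and by
  \<open>hit_step\<close> elsewhere; the balance then makes the average over the next coset finite,
  hence each term of positive mass.\<close>

lemma hit_phi_finite:
  assumes pos_info: "pos_info < \<infinity>" and C: "C \<in> rcosets \<Gamma>"
  shows "hit C phi < \<infinity>"
proof (rule coset_reachable[where Q = "\<lambda>C. hit C phi < \<infinity>", OF trivial_coset _ C])
  show "hit \<Gamma> phi < \<infinity>" by (simp add: hit_phi_trivial_coset)
next
  fix D g assume D: "D \<in> rcosets \<Gamma>" "hit D phi < \<infinity>" and g: "g \<in> set_pmf \<mu>"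
  have "step_hit D phi < \<infinity>"
  proof (cases "D = \<Gamma>")
    case True
    have "pos_info * of_nat (card (rcosets \<Gamma>)) < \<infinity>"
      using pos_info by (simp add: ennreal_mult_less_top of_nat_less_top)
    then show ?thesis using step_hit_phi_le True by (metis le_less_trans)
  next
    case False
    then show ?thesis using D hit_step[OF False, of phi] by (simp add: step_hit_def)
  qed
  then have "step_hit D phi + neg_info < \<infinity>"
    using neg_finite by simp
  then have "(\<integral>\<^sup>+g. hit (D #> g) phi \<partial>\<mu>) < \<infinity>"
    unfolding step_hit_phi[OF D(1)] by simp
  then have "AE g in \<mu>. hit (D #> g) phi \<noteq> \<infinity>"
    by (intro nn_integral_noteq_infinite) auto
  then show "hit (D #> g) phi < \<infinity>"
    using g by (simp add: AE_measure_pmf_iff less_top)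
qed

lemma step_hit_phi_eq: "step_hit \<Gamma> phi = of_nat (card (rcosets \<Gamma>)) * ent"
proof (cases "pos_info < \<infinity>")
  case True
  let ?S = "rcosets \<Gamma>" and ?N = "of_nat (card (rcosets \<Gamma>)) :: ennreal"
  let ?T = "\<Sum>C\<in>?S. hit C phi"
  have T: "?T < \<infinity>" using hit_phi_finite[OF True] by (simp add: fin)
  \<comment> \<open>Only the subgroup distinguishes \<open>step_hit\<close> from \<open>hit\<close>,
    and there \<open>hit\<close> of \<open>phi\<close> is 0.\<close>
  have "(\<Sum>C\<in>?S. step_hit C phi) = step_hit \<Gamma> phi + (\<Sum>C\<in>?S - {\<Gamma>}. step_hit C phi)"
    using sum.remove[OF fin trivial_coset] .
  also have "(\<Sum>C\<in>?S - {\<Gamma>}. step_hit C phi) = (\<Sum>C\<in>?S - {\<Gamma>}. hit C phi)"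
    by (intro sum.cong) (auto simp: hit_step[of _ phi] step_hit_def)
  also have "\<dots> = ?T"
    using sum.remove[OF fin trivial_coset, of "\<lambda>C. hit C phi"] by (simp add: hit_phi_trivial_coset)
  finally have 1: "(\<Sum>C\<in>?S. step_hit C phi) = step_hit \<Gamma> phi + ?T" .
  have "step_hit \<Gamma> phi + ?T + ?N * neg_info = (\<Sum>C\<in>?S. step_hit C phi + neg_info)"
    unfolding 1[symmetric] by (simp add: sum.distrib)
  also have "\<dots> = (\<Sum>C\<in>?S. pos_info + (\<integral>\<^sup>+g. hit (C #> g) phi \<partial>\<mu>))"
    by (intro sum.cong step_hit_phi) simp
  also have "\<dots> = ?N * pos_info + ?T"
    by (simp add: sum.distrib sum_step[of "\<lambda>C. hit C phi"])
  also have "\<dots> = ?N * ent + ?T + ?N * neg_info"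
    unfolding ent_add_neg[symmetric] by (simp add: distrib_left ac_simps)
  finally have "(?T + ?N * neg_info) + step_hit \<Gamma> phi = (?T + ?N * neg_info) + ?N * ent"
    by (simp add: ac_simps)
  \<comment> \<open>Finiteness of the common terms licenses the cancellation in
    \<open>ennreal\<close>.\<close>
  moreover have "?T + ?N * neg_info < \<infinity>"
    using T neg_finite by (simp add: ennreal_mult_less_top of_nat_less_top)
  ultimately show ?thesis
    by (auto simp: ennreal_add_left_cancel)
next
  case False
  \<comment> \<open>Since \<open>neg_info\<close> is finite, an infinite \<open>pos_info\<close>
    makes both sides infinite; the index is nonzero, so the product on the right is infinite as
    well.\<close>
  then have pos_info: "pos_info = \<infinity>" by (metis infinity_ennreal_def less_top)
  then have "ent = \<infinity>" using ent_add_neg neg_finite by auto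
  moreover have "card (rcosets \<Gamma>) \<noteq> 0"
    using fin trivial_coset by auto
  moreover have "step_hit \<Gamma> phi = \<infinity>"
    using step_hit_phi[OF trivial_coset] neg_finite pos_info by auto
  ultimately show ?thesis by (simp add: ennreal_mult_top)
qed

end

section \<open>The hitting measure\<close>

text \<open>Independence makes the joint law a product, and Tonelli applies. Countability makes
  every \<open>f\<close> measurable on the product.\<close>

lemma nn_integral_indep_var:
  assumes P: "prob_space P"
    and ind: "prob_space.indep_var P (count_space A) Y (count_space B) U"
    and cnt: "countable A" "countable B"
  shows "(\<integral>\<^sup>+w. f (Y w) (U w) \<partial>P) = (\<integral>\<^sup>+w. \<integral>\<^sup>+u. f (Y w) (U u) \<partial>P \<partial>P)"
proof -
  interpret prob_space P by fact
  let ?S = "count_space A" and ?T = "count_space B"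
  have Y [measurable]: "Y \<in> measurable P ?S" and U [measurable]: "U \<in> measurable P ?T"
    and eq: "distr P ?S Y \<Otimes>\<^sub>M distr P ?T U = distr P (?S \<Otimes>\<^sub>M ?T) (\<lambda>w. (Y w, U w))"
    using ind by (auto simp: indep_var_distribution_eq)
  interpret Y: prob_space "distr P ?S Y" by (rule prob_space_distr) fact
  interpret U: prob_space "distr P ?T U" by (rule prob_space_distr) fact
  interpret pair_prob_space "distr P ?S Y" "distr P ?T U" ..
  have meas: "case_prod f \<in> borel_measurable (?S \<Otimes>\<^sub>M ?T)"
    using cnt by (simp add: pair_measure_countable)
  have "(\<integral>\<^sup>+w. f (Y w) (U w) \<partial>P) = (\<integral>\<^sup>+z. case_prod f z \<partial>distr P (?S \<Otimes>\<^sub>M ?T) (\<lambda>w. (Y w, U w)))"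
    using meas by (subst nn_integral_distr) auto
  also have "\<dots> = (\<integral>\<^sup>+y. \<integral>\<^sup>+u. f y u \<partial>distr P ?T U \<partial>distr P ?S Y)"
    unfolding eq[symmetric]
    by (subst U.nn_integral_fst[symmetric]) (use meas in \<open>simp_all cong: measurable_cong_sets\<close>)
  also have "\<dots> = (\<integral>\<^sup>+w. \<integral>\<^sup>+u. f (Y w) (U u) \<partial>P \<partial>P)"
    by (subst nn_integral_distr) (auto intro!: nn_integral_cong nn_integral_distr)
  finally show ?thesis .
qed

locale sampled_walk = finite_index_walk G \<mu> \<Gamma>
  for G :: "('g, 'b) monoid_scheme" (structure) and \<mu> \<Gamma> +
  fixes P :: "'w measure" and X :: "nat \<Rightarrow> 'w \<Rightarrow> 'g"
  assumes cnt: "countable (carrier G)"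
    and iid: "iid_increments G \<mu> P X"
begin

sublocale P: prob_space P
  using iid by (simp add: iid_increments_def)

section \<open>The sampled walk before its first return\<close>

abbreviation Z :: "nat \<Rightarrow> 'w \<Rightarrow> 'g" where "Z \<equiv> random_walk G X"

lemma X_measurable: "1 \<le> i \<Longrightarrow> X i \<in> measurable P (count_space (carrier G))"
  using iid by (auto simp: iid_increments_def P.indep_vars_def)

lemma nn_integral_X:
  assumes i: "1 \<le> i"
  shows "(\<integral>\<^sup>+w. f (X i w) \<partial>P) = (\<integral>\<^sup>+g. f g \<partial>\<mu>)"
proof -
  have X: "X i \<in> measurable P (count_space UNIV)"
    using measurable_compose[OF X_measurable[OF i], of "\<lambda>x. x"] by simp
  have "distr P (count_space UNIV) (X i) = measure_pmf \<mu>"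
  proof (rule measure_eqI_countable_AE[where \<Omega> = "carrier G"])
    show "AE g in distr P (count_space UNIV) (X i). g \<in> carrier G"
      using measurable_space[OF X_measurable[OF i]] X by (subst AE_distr_iff) auto
    show "AE g in measure_pmf \<mu>. g \<in> carrier G"
      using supp by (auto simp: AE_measure_pmf_iff)
    fix g assume g: "g \<in> carrier G"
    have "emeasure (distr P (count_space UNIV) (X i)) {g} = emeasure P {w \<in> space P. X i w = g}"
      using X by (subst emeasure_distr) (auto intro!: arg_cong2[where f = emeasure])
    also have "\<dots> = ennreal (pmf \<mu> g)"
      using iid i g by (simp add: P.emeasure_eq_measure iid_increments_def)
    finally show "emeasure (distr P (count_space UNIV) (X i)) {g} = emeasure (measure_pmf \<mu>) {g}"
      by (simp add: emeasure_pmf_single)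
  qed (use cnt in auto)
  then show ?thesis
    using nn_integral_distr[OF X, of f] by simp
qed

text \<open>General in \<open>Y\<close> and \<open>M\<close> because it serves both the sampled
  increments and the coordinate maps on a product space.\<close>

lemma random_walk_measurable:
  assumes "\<And>i. i \<in> {1..n} \<Longrightarrow> Y i \<in> measurable M (count_space (carrier G))"
  shows "random_walk G Y n \<in> measurable M (count_space (carrier G))"
  using assms
proof (induction n)
  case (Suc n)
  have "(\<lambda>w. (random_walk G Y n w, Y (Suc n) w)) \<in> measurable M (count_space (carrier G \<times> carrier G))"
    using Suc cnt by (subst pair_measure_countable[symmetric]) auto
  then have "(\<lambda>w. (\<lambda>(a, b). a \<otimes> b) (random_walk G Y n w, Y (Suc n) w)) \<in> measurable M (count_space (carrier G))"
    by (rule measurable_compose) auto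
  then show ?case by (simp cong: measurable_cong)
next
  case 0
  have "random_walk G Y 0 = (\<lambda>_. \<one>)" by (simp add: fun_eq_iff)
  then show ?case by simp
qed

lemma Z_measurable: "Z n \<in> measurable P (count_space (carrier G))"
  by (rule random_walk_measurable) (auto intro: X_measurable)

lemma Z_carrier: "w \<in> space P \<Longrightarrow> Z n w \<in> carrier G"
  using measurable_space[OF Z_measurable] by simp

lemma Z_in_measurable [measurable]: "Measurable.pred P (\<lambda>w. Z n w \<in> A)"
  using measurable_compose[OF Z_measurable, of "\<lambda>z. z \<in> A"] by simp

lemma random_walk_restrict:
  "n \<le> k \<Longrightarrow> random_walk G (\<lambda>i y. y i) n (restrict (\<lambda>i. X i w) {1..k}) = Z n w"
  by (induction n) auto

text \<open>Time 0 is left out since the walk starts in the subgroup, and time \<open>k\<close> is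
  left out so that a first return at \<open>k\<close> is \<open>avoids k\<close> together with
  membership at \<open>k\<close>.\<close>

abbreviation avoids :: "nat \<Rightarrow> 'w \<Rightarrow> bool" where
  "avoids k w \<equiv> \<forall>j\<in>{1..<k}. Z j w \<notin> \<Gamma>"

text \<open>The flag \<open>True\<close> only serves to give both variables the same type, as the library's
  \<open>indep_var\<close> requires.\<close>

lemma indep_past:
  "P.indep_var (count_space (UNIV \<times> carrier G)) (\<lambda>w. (avoids (Suc k) w, Z k w))
     (count_space (UNIV \<times> carrier G)) (\<lambda>w. (True, X (Suc k) w))"
proof -
  let ?M = "\<lambda>_::nat. count_space (carrier G)"
  let ?W = "random_walk G (\<lambda>i y. y i)"
  let ?R = "\<lambda>J w. restrict (\<lambda>i. X i w) J"
  \<comment> \<open>Disjoint blocks of increments are independent; the past is a function of the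
    first block and the next increment of the second.\<close>
  have ind: "P.indep_var (Pi\<^sub>M {1..k} ?M) (?R {1..k}) (Pi\<^sub>M {Suc k} ?M) (?R {Suc k})"
    using iid by (intro P.indep_var_restrict[where I = "{1..}"]) (auto simp: iid_increments_def)
  have W: "?W n \<in> measurable (Pi\<^sub>M {1..k} ?M) (count_space (carrier G))" if "n \<le> k" for n
    using that by (intro random_walk_measurable measurable_component_singleton) auto
  have pred: "Measurable.pred (Pi\<^sub>M {1..k} ?M) (\<lambda>y. \<forall>j\<in>{1..<Suc k}. ?W j y \<notin> \<Gamma>)"
    using measurable_compose[OF W, of _ "\<lambda>z. z \<notin> \<Gamma>"] by (intro pred_intros_finite) auto
  have past: "(\<lambda>y. (\<forall>j\<in>{1..<Suc k}. ?W j y \<notin> \<Gamma>, ?W k y))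
      \<in> measurable (Pi\<^sub>M {1..k} ?M) (count_space (UNIV \<times> carrier G))"
    using cnt pred W[of k] by (subst pair_measure_countable[symmetric]) auto
  have "P.indep_var (count_space (UNIV \<times> carrier G))
      ((\<lambda>y. (\<forall>j\<in>{1..<Suc k}. ?W j y \<notin> \<Gamma>, ?W k y)) \<circ> ?R {1..k})
      (count_space (UNIV \<times> carrier G)) ((\<lambda>y. (True, y (Suc k))) \<circ> ?R {Suc k})"
    by (rule P.indep_var_compose[OF ind past])
      (rule measurable_compose[OF measurable_component_singleton[of "Suc k"]], auto)
  moreover have "(\<lambda>y. (\<forall>j\<in>{1..<Suc k}. ?W j y \<notin> \<Gamma>, ?W k y)) \<circ> ?R {1..k}
      = (\<lambda>w. (avoids (Suc k) w, Z k w))"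
  proof
    fix w
    have "?W j (?R {1..k} w) = Z j w" if "j \<le> k" for j
      using that by (rule random_walk_restrict)
    then show "((\<lambda>y. (\<forall>j\<in>{1..<Suc k}. ?W j y \<notin> \<Gamma>, ?W k y)) \<circ> ?R {1..k}) w = (avoids (Suc k) w, Z k w)"
      by (auto simp del: One_nat_def)
  qed
  moreover have "(\<lambda>y. (True, y (Suc k))) \<circ> ?R {Suc k} = (\<lambda>w. (True, X (Suc k) w))"
    by (auto simp: fun_eq_iff)
  ultimately show ?thesis by simp
qed

text \<open>Split by whether the walk is in the subgroup at time \<open>k\<close>. If it is, the
  stopped expectation is \<open>f\<close> at that point; if not, it takes one more step, and
  independence identifies that step with \<open>X (Suc k)\<close>.\<close>

lemma step_avoiding:
  assumes k: "1 \<le> k"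
  shows "(\<integral>\<^sup>+w. of_bool (avoids k w) * hit_within (Suc n) (\<Gamma> #> Z k w) (\<lambda>h. f (Z k w \<otimes> h)) \<partial>P)
    = (\<integral>\<^sup>+w. of_bool (avoids k w \<and> Z k w \<in> \<Gamma>) * f (Z k w) \<partial>P)
    + (\<integral>\<^sup>+w. of_bool (avoids (Suc k) w) * hit_within n (\<Gamma> #> Z (Suc k) w) (\<lambda>h. f (Z (Suc k) w \<otimes> h)) \<partial>P)"
proof -
  \<comment> \<open>The integrand as a function of the past (flag and position) and one fresh
    increment, the shape needed for independence.\<close>
  define \<psi> where "\<psi> = (\<lambda>(b, z) g. of_bool b * hit_within n (\<Gamma> #> (z \<otimes> g)) (\<lambda>h. f (z \<otimes> g \<otimes> h)))"
  have avoids_Suc: "avoids (Suc k) w \<longleftrightarrow> avoids k w \<and> Z k w \<notin> \<Gamma>" for w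
    using k by (auto simp: less_Suc_eq)
  have "(\<integral>\<^sup>+w. of_bool (avoids k w) * hit_within (Suc n) (\<Gamma> #> Z k w) (\<lambda>h. f (Z k w \<otimes> h)) \<partial>P)
      = (\<integral>\<^sup>+w. of_bool (avoids k w \<and> Z k w \<in> \<Gamma>) * f (Z k w)
          + (\<integral>\<^sup>+g. \<psi> (avoids (Suc k) w, Z k w) g \<partial>\<mu>) \<partial>P)"
  proof (rule nn_integral_cong)
    fix w assume w: "w \<in> space P"
    have "(\<integral>\<^sup>+g. \<psi> (avoids (Suc k) w, Z k w) g \<partial>\<mu>)
        = of_bool (avoids (Suc k) w) * (\<integral>\<^sup>+g. hit_within n (\<Gamma> #> Z k w #> g) (\<lambda>h. f (Z k w \<otimes> (g \<otimes> h))) \<partial>\<mu>)"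
    proof -
      have "\<psi> (avoids (Suc k) w, Z k w) g
          = of_bool (avoids (Suc k) w) * hit_within n (\<Gamma> #> Z k w #> g) (\<lambda>h. f (Z k w \<otimes> (g \<otimes> h)))"
        if "g \<in> set_pmf \<mu>" for g
        unfolding \<psi>_def using Z_carrier[OF w] supp_carrier[OF that]
        by (simp only: prod.case coset_mult) (auto intro!: arg_cong2[where f = "(*)"] hit_within_cong simp: m_assoc)
      then have "(\<integral>\<^sup>+g. \<psi> (avoids (Suc k) w, Z k w) g \<partial>\<mu>) = (\<integral>\<^sup>+g. of_bool (avoids (Suc k) w)
          * hit_within n (\<Gamma> #> Z k w #> g) (\<lambda>h. f (Z k w \<otimes> (g \<otimes> h))) \<partial>\<mu>)"
        by (rule mu_cong)
      then show ?thesis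
        using nn_integral_cmult[of "\<lambda>g. hit_within n (\<Gamma> #> Z k w #> g) (\<lambda>h. f (Z k w \<otimes> (g \<otimes> h)))" \<mu>
            "of_bool (avoids (Suc k) w)"] by simp
    qed
    then show "of_bool (avoids k w) * hit_within (Suc n) (\<Gamma> #> Z k w) (\<lambda>h. f (Z k w \<otimes> h))
        = of_bool (avoids k w \<and> Z k w \<in> \<Gamma>) * f (Z k w) + (\<integral>\<^sup>+g. \<psi> (avoids (Suc k) w, Z k w) g \<partial>\<mu>)"
      using Z_carrier[OF w, of k] unfolding avoids_Suc by (simp add: coset_eq_iff)
  qed
  also have "\<dots> = (\<integral>\<^sup>+w. of_bool (avoids k w \<and> Z k w \<in> \<Gamma>) * f (Z k w) \<partial>P)
      + (\<integral>\<^sup>+w. \<integral>\<^sup>+g. \<psi> (avoids (Suc k) w, Z k w) g \<partial>\<mu> \<partial>P)"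
  proof (rule nn_integral_add)
    have "(\<lambda>w. f (Z k w)) \<in> borel_measurable P"
      by (rule measurable_compose[OF Z_measurable]) simp
    then show "(\<lambda>w. of_bool (avoids k w \<and> Z k w \<in> \<Gamma>) * f (Z k w)) \<in> borel_measurable P"
      by measurable
    have "(\<lambda>w. (avoids (Suc k) w, Z k w)) \<in> measurable P (count_space (UNIV \<times> carrier G))"
      using indep_past[of k] by (simp add: P.indep_var_distribution_eq)
    then show "(\<lambda>w. \<integral>\<^sup>+g. \<psi> (avoids (Suc k) w, Z k w) g \<partial>\<mu>) \<in> borel_measurable P"
      by (rule measurable_compose[where g = "\<lambda>y. \<integral>\<^sup>+g. \<psi> y g \<partial>\<mu>"]) simp
  qed
  also have "(\<integral>\<^sup>+w. \<integral>\<^sup>+g. \<psi> (avoids (Suc k) w, Z k w) g \<partial>\<mu> \<partial>P)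
      = (\<integral>\<^sup>+w. \<integral>\<^sup>+u. \<psi> (avoids (Suc k) w, Z k w) (X (Suc k) u) \<partial>P \<partial>P)"
    by (simp add: nn_integral_X)
  also have "\<dots> = (\<integral>\<^sup>+w. \<psi> (avoids (Suc k) w, Z k w) (X (Suc k) w) \<partial>P)"
    using nn_integral_indep_var[OF P.prob_space_axioms indep_past[of k], of "\<lambda>y u. \<psi> y (snd u)"] cnt
    by simp
  finally show ?thesis
    by (simp add: \<psi>_def)
qed

text \<open>Iterating \<open>step_avoiding\<close> leaves no remainder, because the stopped
  expectation at level 0 is 0.\<close>

lemma hit_within_avoiding:
  "1 \<le> k \<Longrightarrow> (\<integral>\<^sup>+w. of_bool (avoids k w) * hit_within n (\<Gamma> #> Z k w) (\<lambda>h. f (Z k w \<otimes> h)) \<partial>P)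
    = (\<Sum>j<n. \<integral>\<^sup>+w. of_bool (avoids (k + j) w \<and> Z (k + j) w \<in> \<Gamma>) * f (Z (k + j) w) \<partial>P)"
proof (induction n arbitrary: k)
  case (Suc n)
  show ?case
    unfolding step_avoiding[OF Suc.prems] sum.lessThan_Suc_shift
    by (subst Suc.IH) simp_all
qed simp

text \<open>Start at time 1, where avoidance is vacuous and the position is \<open>X 1\<close> with
  law \<open>\<mu>\<close>, and let the truncation level grow.\<close>

lemma nn_integral_first_return:
  "(\<Sum>j. \<integral>\<^sup>+w. of_bool (avoids (Suc j) w \<and> Z (Suc j) w \<in> \<Gamma>) * f (Z (Suc j) w) \<partial>P)
     = (\<integral>\<^sup>+g. hit (\<Gamma> #> g) (\<lambda>h. f (g \<otimes> h)) \<partial>\<mu>)"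
proof -
  have "(\<Sum>j<n. \<integral>\<^sup>+w. of_bool (avoids (Suc j) w \<and> Z (Suc j) w \<in> \<Gamma>) * f (Z (Suc j) w) \<partial>P)
      = (\<integral>\<^sup>+g. hit_within n (\<Gamma> #> g) (\<lambda>h. f (g \<otimes> h)) \<partial>\<mu>)" for n
  proof -
    have X1: "Z 1 w = X 1 w" if "w \<in> space P" for w
      using measurable_space[OF X_measurable that] by simp
    have "(\<Sum>j<n. \<integral>\<^sup>+w. of_bool (avoids (Suc j) w \<and> Z (Suc j) w \<in> \<Gamma>) * f (Z (Suc j) w) \<partial>P)
        = (\<integral>\<^sup>+w. hit_within n (\<Gamma> #> X 1 w) (\<lambda>h. f (X 1 w \<otimes> h)) \<partial>P)"
      using hit_within_avoiding[of 1 n f] X1 by (simp del: random_walk.simps cong: nn_integral_cong)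
    then show ?thesis
      using nn_integral_X[of 1 "\<lambda>g. hit_within n (\<Gamma> #> g) (\<lambda>h. f (g \<otimes> h))"] by simp
  qed
  then show ?thesis
    unfolding suminf_eq_SUP nn_integral_hit by simp
qed

section \<open>The return time and the law at that time\<close>

definition returns :: "'w \<Rightarrow> bool" where
  "returns w \<longleftrightarrow> (\<exists>n\<ge>1. Z n w \<in> \<Gamma>)"

abbreviation Zret :: "'w \<Rightarrow> 'g" where "Zret w \<equiv> Z (return_time G X \<Gamma> w) w"

lemma Zret_in: "returns w \<Longrightarrow> Zret w \<in> \<Gamma>"
  unfolding returns_def return_time_def by (rule LeastI2_ex) auto

text \<open>The conjunct \<open>returns w\<close> excludes paths on which the \<open>LEAST\<close>
  in the return time is unspecified.\<close>

lemma first_return_iff: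
  "avoids (Suc j) w \<and> Z (Suc j) w \<in> \<Gamma> \<longleftrightarrow> returns w \<and> return_time G X \<Gamma> w = Suc j"
proof
  assume *: "avoids (Suc j) w \<and> Z (Suc j) w \<in> \<Gamma>"
  then have "return_time G X \<Gamma> w = Suc j"
    unfolding return_time_def by (intro Least_equality) (auto simp: not_less[symmetric])
  then show "returns w \<and> return_time G X \<Gamma> w = Suc j"
    using * unfolding returns_def by force
next
  assume *: "returns w \<and> return_time G X \<Gamma> w = Suc j"
  then have "Z (Suc j) w \<in> \<Gamma>" using Zret_in by metis
  moreover have "Z i w \<notin> \<Gamma>" if "i \<in> {1..<Suc j}" for i
    using not_less_Least[of i "\<lambda>n. 1 \<le> n \<and> Z n w \<in> \<Gamma>"] * that by (auto simp: return_time_def)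
  ultimately show "avoids (Suc j) w \<and> Z (Suc j) w \<in> \<Gamma>" by blast
qed

text \<open>On a returning path exactly one index equals the return time; on any other path all
  terms vanish.\<close>

lemma sum_first_return:
  "(\<Sum>j. of_bool (avoids (Suc j) w \<and> Z (Suc j) w \<in> \<Gamma>) * f (Z (Suc j) w) :: ennreal)
     = of_bool (returns w) * f (Zret w)"
  unfolding first_return_iff
proof (cases "returns w")
  case True
  then have "1 \<le> return_time G X \<Gamma> w"
    unfolding returns_def return_time_def by (rule LeastI2_ex) auto
  then obtain m where m: "return_time G X \<Gamma> w = Suc m"
    by (cases "return_time G X \<Gamma> w") auto
  have "(\<Sum>j. of_bool (returns w \<and> return_time G X \<Gamma> w = Suc j) * f (Z (Suc j) w))
      = (\<Sum>j\<in>{m}. of_bool (returns w \<and> return_time G X \<Gamma> w = Suc j) * f (Z (Suc j) w))"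
    by (rule suminf_finite) (auto simp: m)
  then show "(\<Sum>j. of_bool (returns w \<and> return_time G X \<Gamma> w = Suc j) * f (Z (Suc j) w))
      = of_bool (returns w) * f (Zret w)"
    using True by (simp add: m)
qed simp

lemma nn_integral_returns:
  "(\<integral>\<^sup>+w. of_bool (returns w) * f (Zret w) \<partial>P) = (\<integral>\<^sup>+g. hit (\<Gamma> #> g) (\<lambda>h. f (g \<otimes> h)) \<partial>\<mu>)"
proof -
  have "(\<lambda>w. of_bool (avoids (Suc j) w \<and> Z (Suc j) w \<in> \<Gamma>) * f (Z (Suc j) w)) \<in> borel_measurable P" for j
    using measurable_compose[OF Z_measurable[of "Suc j"], of f borel] by measurable
  then show ?thesis
    unfolding sum_first_return[symmetric] nn_integral_first_return[symmetric]
    by (rule nn_integral_suminf)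
qed

lemma returns_measurable [measurable]: "Measurable.pred P returns"
  unfolding returns_def by measurable

text \<open>Take the constant function 1 in \<open>nn_integral_returns\<close>: after the first step
  the coset walk hits the subgroup with probability 1.\<close>

lemma AE_returns: "AE w in P. returns w"
proof -
  have "(\<integral>\<^sup>+w. of_bool (returns w) \<partial>P) = (\<integral>\<^sup>+g. hit (\<Gamma> #> g) (\<lambda>_. 1) \<partial>\<mu>)"
    using nn_integral_returns[of "\<lambda>_. 1"] by simp
  also have "\<dots> = (\<integral>\<^sup>+g. 1 \<partial>\<mu>)"
    by (intro mu_cong hit_one translate_coset trivial_coset supp_carrier)
  also have "\<dots> = 1" by (rule mu_const)
  finally have "emeasure P {w \<in> space P. returns w} = 1"
    by (subst nn_integral_indicator[symmetric]) (auto simp: indicator_def of_bool_def cong: nn_integral_cong)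
  then show ?thesis
    by (intro P.AE_I_eq_1) auto
qed

lemma nn_integral_Zret:
  "(\<integral>\<^sup>+w. f (Zret w) \<partial>P) = (\<integral>\<^sup>+g. hit (\<Gamma> #> g) (\<lambda>h. f (g \<otimes> h)) \<partial>\<mu>)"
  unfolding nn_integral_returns[symmetric]
  by (rule nn_integral_cong_AE) (use AE_returns in eventually_elim, simp)

lemma return_time_measurable [measurable]:
  "return_time G X \<Gamma> \<in> measurable P (count_space UNIV)"
  unfolding return_time_def by measurable

lemma Zret_measurable: "Measurable.pred P (\<lambda>w. Zret w = \<gamma>)"
proof -
  have [measurable]: "Measurable.pred P (\<lambda>w. Z n w = \<gamma>)" for n
    using Z_in_measurable[of n "{\<gamma>}"] by simp
  show ?thesis
    by (rule measurable_compose_countable[where g = "return_time G X \<Gamma>"]) measurable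
qed

text \<open>The hitting measure is the law of \<open>Zret\<close>: write its point masses as
  integrals of indicators and exchange the order of integration. \<open>Zret\<close> lies in the
  subgroup only on returning paths, hence almost surely.\<close>

lemma nn_integral_hitting_measure:
  "(\<integral>\<^sup>+\<gamma>. ennreal (hitting_measure G P X \<Gamma> \<gamma>) * f \<gamma> \<partial>count_space \<Gamma>)
     = (\<integral>\<^sup>+g. hit (\<Gamma> #> g) (\<lambda>h. f (g \<otimes> h)) \<partial>\<mu>)"
proof -
  have cnt\<Gamma>: "countable \<Gamma>" using sub_carrier cnt countable_subset by blast
  interpret C: sigma_finite_measure "count_space \<Gamma>"
    by (rule sigma_finite_measure_count_space_countable[OF cnt\<Gamma>])
  interpret PC: pair_sigma_finite "count_space \<Gamma>" P ..
  have "(\<integral>\<^sup>+\<gamma>. ennreal (hitting_measure G P X \<Gamma> \<gamma>) * f \<gamma> \<partial>count_space \<Gamma>)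
      = (\<integral>\<^sup>+\<gamma>. \<integral>\<^sup>+w. f \<gamma> * indicator {Zret w} \<gamma> \<partial>P \<partial>count_space \<Gamma>)"
  proof (rule nn_integral_cong)
    fix \<gamma>
    have m: "{w \<in> space P. Zret w = \<gamma>} \<in> sets P"
      using Zret_measurable by simp
    have "(\<integral>\<^sup>+w. f \<gamma> * indicator {Zret w} \<gamma> \<partial>P)
        = (\<integral>\<^sup>+w. f \<gamma> * indicator {w \<in> space P. Zret w = \<gamma>} w \<partial>P)"
      by (rule nn_integral_cong) (auto split: split_indicator)
    also have "\<dots> = f \<gamma> * emeasure P {w \<in> space P. Zret w = \<gamma>}"
      using m by (rule nn_integral_cmult_indicator)
    finally show "ennreal (hitting_measure G P X \<Gamma> \<gamma>) * f \<gamma> = (\<integral>\<^sup>+w. f \<gamma> * indicator {Zret w} \<gamma> \<partial>P)"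
      by (simp add: hitting_measure_def P.emeasure_eq_measure mult.commute)
  qed
  also have "\<dots> = (\<integral>\<^sup>+w. \<integral>\<^sup>+\<gamma>. f \<gamma> * indicator {Zret w} \<gamma> \<partial>count_space \<Gamma> \<partial>P)"
  proof (rule PC.Fubini'[symmetric])
    have "(\<lambda>w. f \<gamma> * indicator {Zret w} \<gamma>) \<in> borel_measurable P" for \<gamma>
    proof -
      have "(\<lambda>w. f \<gamma> * indicator {Zret w} \<gamma>) = (\<lambda>w. if Zret w = \<gamma> then f \<gamma> else 0)"
        by (auto simp: fun_eq_iff)
      then show ?thesis
        by (simp only:) (rule measurable_If[OF measurable_const measurable_const
            Zret_measurable[unfolded pred_def]], auto)
    qed
    then show "(\<lambda>(\<gamma>, w). f \<gamma> * indicator {Zret w} \<gamma>) \<in> borel_measurable (count_space \<Gamma> \<Otimes>\<^sub>M P)"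
      using cnt\<Gamma> by (intro measurable_pair_measure_countable1) auto
  qed
  also have "\<dots> = (\<integral>\<^sup>+w. f (Zret w) \<partial>P)"
  proof (rule nn_integral_cong_AE, use AE_returns in eventually_elim)
    fix w assume "returns w"
    then have "Zret w \<in> \<Gamma>" by (rule Zret_in)
    then show "(\<integral>\<^sup>+\<gamma>. f \<gamma> * indicator {Zret w} \<gamma> \<partial>count_space \<Gamma>) = f (Zret w)"
      by (subst nn_integral_indicator_singleton) auto
  qed
  finally show ?thesis by (simp add: nn_integral_Zret)
qed

end

section \<open>From the coset balance to the entropy formula\<close>

theorem theorem1p1:
  fixes G :: "('g, 'b) monoid_scheme" and \<mu> :: "'g pmf" and \<Gamma> :: "'g set"
    and P :: "'w measure" and X :: "nat \<Rightarrow> 'w \<Rightarrow> 'g"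
    and act :: "'g \<Rightarrow> 'x \<Rightarrow> 'x" and \<nu> :: "'x measure"
  assumes "group G" and "countable (carrier G)"
    and "set_pmf \<mu> \<subseteq> carrier G" and "generating G \<mu>" and "shannon_entropy G \<mu> < \<infinity>"
    and "subgroup \<Gamma> G" and "finite (rcosets\<^bsub>G\<^esub> \<Gamma>)"
    and "iid_increments G \<mu> P X"
    and "stationary_space G \<mu> act \<nu>"
  shows "furstenberg_entropy G \<Gamma> (hitting_measure G P X \<Gamma>) act \<nu> =
         of_nat (card (rcosets\<^bsub>G\<^esub> \<Gamma>)) * furstenberg_entropy G (carrier G) (pmf \<mu>) act \<nu>"
proof -
  interpret stationary_walk G \<mu> \<Gamma> act \<nu>
    using assms by (simp add: stationary_walk_def finite_index_walk_def finite_index_walk_axioms_def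
        stationary_action_def stationary_action_axioms_def)
  interpret walk: sampled_walk G \<mu> \<Gamma> P X
    using assms by unfold_locales
  have "furstenberg_entropy G (carrier G) (pmf \<mu>) act \<nu>
      = (\<integral>\<^sup>+g. ennreal (pmf \<mu> g) * ennreal (phi g) \<partial>count_space (carrier G))"
    by (simp add: furstenberg_entropy_def rn_information_eq ennreal_mult' cong: nn_integral_cong)
  also have "\<dots> = (\<integral>\<^sup>+g. ennreal (pmf \<mu> g) * ennreal (phi g) \<partial>count_space UNIV)"
    using supp by (intro nn_integral_count_space_eq) (auto simp: pmf_eq_0_set_pmf)
  also have "\<dots> = ent"
    by (simp add: ent_def nn_integral_measure_pmf)
  finally have ent: "furstenberg_entropy G (carrier G) (pmf \<mu>) act \<nu> = ent" .
  have "furstenberg_entropy G \<Gamma> (hitting_measure G P X \<Gamma>) act \<nu>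
      = (\<integral>\<^sup>+\<gamma>. ennreal (hitting_measure G P X \<Gamma> \<gamma>) * ennreal (phi \<gamma>) \<partial>count_space \<Gamma>)"
    by (simp add: furstenberg_entropy_def rn_information_eq ennreal_mult' hitting_measure_def
        cong: nn_integral_cong)
  \<comment> \<open>The entropy for the hitting measure is the expectation of \<open>phi\<close> at
    the first return, which the coset balance evaluates.\<close>
  also have "\<dots> = step_hit \<Gamma> phi"
    unfolding step_hit_def by (rule walk.nn_integral_hitting_measure)
  also have "\<dots> = of_nat (card (rcosets\<^bsub>G\<^esub> \<Gamma>)) * ent"
    by (rule step_hit_phi_eq)
  finally show ?thesis unfolding ent .
qed

end
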